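(* For every full-column-rank matrix $C\in\mathbb R^{n\times r}$ (with $0\le r\le n$), $$\operatorname{MSD}(\mathcal T(C))\le\min\{n-r,\,r\}.$$
   Context: $\mathbb S^p$ is the space of real symmetric $p\times p$ matrices with inner product $\langle X,Y\rangle=\operatorname{tr}(XY)$, and $\mathbb S^p_+$ is the positive semidefinite cone. Matrices in $\mathbb S^{q+1}$ have rows and columns indexed by $0,1,\dots,q$. For $h\in\mathbb R^q$ ($q\ge0$) let $$\Phi(h)=\begin{pmatrix}0&-\frac12h^T\\-\frac12h&hh^T\end{pmatrix}\in\mathbb S^{q+1}.$$ For $H\in\mathbb R^{n\times q}$ with rows $h_1^T,\dots,h_n^T$ let $$\mathcal T(H)=\{Z\in\mathbb S^{q+1}_+: Z_{00}=1,\ \langle\Phi(h_i),Z\rangle=0,\ i=1,\dots,n\}.$$ In particular $\mathcal T(H)=\{1\}\subset\mathbb S^1_+$ when $q=0$. Maximum singularity degree: for a set $S$, $S^\perp=\{z:\langle z,s\rangle=0\ \forall s\in S\}$; for a cone $K$, $K^*=\{z:\langle z,x\rangle\ge0\ \forall x\in K\}$. Let $L\subseteq\mathbb S^p$ be an affine subspace with $L\cap\mathbb S^p_+\ne\emptyset$ and let $F_{\min}$ be the minimal face of $\mathbb S^p_+$ containing $L\cap\mathbb S^p_+$. A facial-reduction sequence of length $d\ge0$ consists of faces $F_0=\mathbb S^p_+,F_1,\dots,F_d$ and matrices $W_j\in L^\perp\cap(F_{j-1}^*\setminus F_{j-1}^\perp)$ with $F_j=F_{j-1}\cap W_j^\perp$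 ($j=1,\dots,d$), and $F_d=F_{\min}$. The maximum singularity degree $\operatorname{MSD}(L\cap\mathbb S^p_+)$ is the maximum length of a facial-reduction sequence; for $\mathcal T(H)$ it is taken with respect to the affine subspace $L$ defined by its equality constraints. *)

theory Defs
  imports
    "Jordan_Normal_Form.DL_Rank"
    "HOL-Library.Extended_Nat"
begin

text \<open>
  Dimensions may be zero and vary (\<open>q\<close> against \<open>q + 1\<close>), so matrices carry their
  dimensions explicitly.
\<close>

definition sym_mats :: "nat \<Rightarrow> real mat set" where
  "sym_mats p = {X \<in> carrier_mat p p. transpose_mat X = X}"

definition psd_cone :: "nat \<Rightarrow> real mat set" where
  "psd_cone p = {X \<in> sym_mats p. \<forall>v \<in> carrier_vec p. 0 \<le> v \<bullet> (X *\<^sub>v v)}"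

definition mat_trace :: "real mat \<Rightarrow> real" where
  "mat_trace A = (\<Sum>i<dim_row A. A $$ (i, i))"

definition mat_inner :: "real mat \<Rightarrow> real mat \<Rightarrow> real" where
  "mat_inner X Y = mat_trace (X * Y)"

definition perp :: "nat \<Rightarrow> real mat set \<Rightarrow> real mat set" where
  "perp p S = {Z \<in> sym_mats p. \<forall>X \<in> S. mat_inner Z X = 0}"

definition dual_cone :: "nat \<Rightarrow> real mat set \<Rightarrow> real mat set" where
  "dual_cone p K = {Z \<in> sym_mats p. \<forall>X \<in> K. 0 \<le> mat_inner Z X}"

text \<open>
  The usual notion of a face of a convex set, as in \<open>face_of\<close> of HOL-Analysis, which does
  not apply because \<open>real mat\<close> is not a vector space type.
\<close>

definition mat_convex :: "real mat set \<Rightarrow> bool" where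
  "mat_convex F \<longleftrightarrow>
     (\<forall>X \<in> F. \<forall>Y \<in> F. \<forall>t::real. 0 \<le> t \<and> t \<le> 1 \<longrightarrow> (1 - t) \<cdot>\<^sub>m X + t \<cdot>\<^sub>m Y \<in> F)"

definition mat_face_of :: "real mat set \<Rightarrow> real mat set \<Rightarrow> bool" where
  "mat_face_of F K \<longleftrightarrow> F \<subseteq> K \<and> mat_convex F \<and>
     (\<forall>X \<in> K. \<forall>Y \<in> K. \<forall>t::real.
        0 < t \<and> t < 1 \<and> (1 - t) \<cdot>\<^sub>m X + t \<cdot>\<^sub>m Y \<in> F \<longrightarrow> X \<in> F \<and> Y \<in> F)"

definition min_face :: "nat \<Rightarrow> real mat set \<Rightarrow> real mat set" where
  "min_face p S = \<Inter> {F. mat_face_of F (psd_cone p) \<and> S \<subseteq> F}"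

definition facial_reduction_seq ::
  "nat \<Rightarrow> real mat set \<Rightarrow> nat \<Rightarrow> (nat \<Rightarrow> real mat set) \<Rightarrow> (nat \<Rightarrow> real mat) \<Rightarrow> bool" where
  "facial_reduction_seq p L d F W \<longleftrightarrow>
     F 0 = psd_cone p \<and>
     (\<forall>j \<le> d. mat_face_of (F j) (psd_cone p)) \<and>
     (\<forall>j \<in> {1..d}.
        W j \<in> perp p L \<inter> (dual_cone p (F (j - 1)) - perp p (F (j - 1))) \<and>
        F j = F (j - 1) \<inter> perp p {W j}) \<and>
     F d = min_face p (L \<inter> psd_cone p)"

text \<open>
  \<open>msd p L\<close> is the maximum singularity degree of \<open>L \<inter> psd_cone p\<close> with respect to the affine
  subspace \<open>L\<close>. The supremum is taken in \<^typ>\<open>enat\<close> so that an unbounded set of lengths would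
  give \<open>\<infinity>\<close>.
\<close>

definition msd :: "nat \<Rightarrow> real mat set \<Rightarrow> enat" where
  "msd p L = (SUP d \<in> {d. \<exists>F W. facial_reduction_seq p L d F W}. enat d)"

definition Phi :: "real vec \<Rightarrow> real mat" where
  "Phi h = (let c = mat_of_cols (dim_vec h) [h] in
     four_block_mat (0\<^sub>m 1 1) ((- 1 / 2) \<cdot>\<^sub>m transpose_mat c)
                    ((- 1 / 2) \<cdot>\<^sub>m c)  (c * transpose_mat c))"

definition T_affine :: "real mat \<Rightarrow> real mat set" where
  "T_affine H = {Z \<in> sym_mats (dim_col H + 1).
     Z $$ (0, 0) = 1 \<and> (\<forall>i < dim_row H. mat_inner (Phi (row H i)) Z = 0)}"

definition T_set :: "real mat \<Rightarrow> real mat set" where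
  "T_set H = {Z \<in> psd_cone (dim_col H + 1).
     Z $$ (0, 0) = 1 \<and> (\<forall>i < dim_row H. mat_inner (Phi (row H i)) Z = 0)}"

lemma T_set_eq: "T_set H = T_affine H \<inter> psd_cone (dim_col H + 1)"
  unfolding T_set_def T_affine_def psd_cone_def by auto

definition MSD_T :: "real mat \<Rightarrow> enat" where
  "MSD_T H = msd (dim_col H + 1) (T_affine H)"

lemma Phi_carrier: "h \<in> carrier_vec q \<Longrightarrow> Phi h \<in> carrier_mat (q + 1) (q + 1)"
  by (auto simp: Phi_def Let_def)

lemma Phi_index:
  assumes "h \<in> carrier_vec q" "i < q" "j < q"
  shows "Phi h $$ (0, 0) = 0" "Phi h $$ (0, Suc j) = - h $ j / 2"
    "Phi h $$ (Suc i, 0) = - h $ i / 2" "Phi h $$ (Suc i, Suc j) = h $ i * h $ j"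
  using assms by (auto simp: Phi_def Let_def scalar_prod_def mat_of_cols_index)

end

theory Submission
  imports Defs "HOL-Library.Function_Algebras"
begin

text \<open>
  Pass from \<open>v\<close> to \<open>u = C v\<close>. A matrix \<open>W\<close> orthogonal to the affine space is \<open>\<Sum>\<^sub>i y\<^sub>i \<Phi>(c\<^sub>i)\<close>,
  and its quadratic form at \<open>(t, v)\<close> is \<open>\<Sum>\<^sub>i y\<^sub>i u\<^sub>i\<^sup>2 - t \<Sum>\<^sub>i y\<^sub>i u\<^sub>i\<close>. As faces are spanned by rank-one
  matrices, a facial reduction sequence becomes a strictly decreasing chain of subspaces
  \<open>U\<^sub>0 = range C \<supset> U\<^sub>1 \<supset> \<dots> \<supset> U\<^sub>d\<close> of \<open>\<real>\<^sup>n\<close> where \<open>y \<bottom> U\<^sub>j\<close>, \<open>Diag y\<close> is positive semidefinite on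
  \<open>U\<^sub>j\<close>, and \<open>U\<^sub>j\<^sub>+\<^sub>1\<close> is its kernel there. Since \<open>dim U\<^sub>0 = r\<close>, clearly \<open>d \<le> r\<close>.

  The bound \<open>d + dim U\<^sub>0 \<le> n\<close> is by induction on \<open>n\<close>. Let \<open>B\<close> be the support of the first \<open>y\<close>.
  On \<open>B\<close>, both \<open>y\<close> and \<open>y u\<close> for \<open>u \<in> U\<^sub>1\<close> are orthogonal to \<open>U\<^sub>0\<close>, which bounds the dimension of
  \<open>U\<^sub>1\<close> restricted to \<open>B\<close>, with one dimension to spare unless \<open>U\<^sub>1\<close> contains a vector that is
  constantly \<open>1\<close> on \<open>B\<close>. The induction hypothesis applies to the vectors of \<open>U\<^sub>1\<close> that vanish on
  \<open>B\<close>, or, in the exceptional case, to those constant on \<open>B\<close>, whose coordinates in \<open>B\<close> merge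
  into one.
\<close>

section \<open>Finite-dimensional subspaces of real vector spaces\<close>

text \<open>Vectors are functions under pointwise operations, so that all coordinate sets share one
  ambient space.\<close>

instantiation "fun" :: (type, real_vector) real_vector
begin

definition scaleR_fun :: "real \<Rightarrow> ('a \<Rightarrow> 'b) \<Rightarrow> 'a \<Rightarrow> 'b" where
  "scaleR_fun c f = (\<lambda>x. c *\<^sub>R f x)"

instance
  by standard (auto simp: scaleR_fun_def fun_eq_iff scaleR_add_right scaleR_add_left)

end

lemma scaleR_fun_apply [simp]: "(c *\<^sub>R f) x = c *\<^sub>R f x"
  by (simp add: scaleR_fun_def)

text \<open>The ambient type may be infinite-dimensional, and \<open>dim\<close> is 0 on a set with
  an infinite basis, so monotonicity of \<open>dim\<close> needs this condition.\<close>

definition fin_dim :: "'a::real_vector set \<Rightarrow> bool" where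
  "fin_dim U \<longleftrightarrow> (\<exists>S. finite S \<and> U \<subseteq> span S)"

lemma fin_dim_subset: "V \<subseteq> U \<Longrightarrow> fin_dim U \<Longrightarrow> fin_dim V"
  unfolding fin_dim_def by blast

lemma fin_dim_independent:
  assumes "fin_dim U" "independent B" "B \<subseteq> U"
  shows "finite B"
proof -
  obtain S where "finite S" "U \<subseteq> span S"
    using assms by (auto simp: fin_dim_def)
  then show ?thesis
    using independent_span_bound[of S B] assms by blast
qed

lemma fin_dim_image:
  assumes "linear f" "fin_dim U"
  shows "fin_dim (f ` U)"
proof -
  obtain S where "finite S" "U \<subseteq> span S"
    using assms by (auto simp: fin_dim_def)
  then have "f ` U \<subseteq> span (f ` S)"
    using linear_span_image[OF assms(1)] by blast
  then show ?thesis
    using \<open>finite S\<close> by (auto simp: fin_dim_def)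
qed

lemma independent_card_le_dim_fin_dim:
  assumes "fin_dim U" "independent B" "B \<subseteq> U"
  shows "card B \<le> dim U"
proof -
  obtain A where A: "A \<subseteq> U" "independent A" "U \<subseteq> span A" "card A = dim U"
    by (rule basis_exists)
  have "finite A"
    using assms(1) A(1,2) by (metis fin_dim_independent)
  then show ?thesis
    using independent_span_bound[of A B] A assms by auto
qed

lemma dim_mono_fin_dim:
  assumes "fin_dim U" "V \<subseteq> U"
  shows "dim V \<le> dim U"
proof -
  obtain A where A: "A \<subseteq> V" "independent A" "V \<subseteq> span A" "card A = dim V"
    by (rule basis_exists)
  show ?thesis
    using independent_card_le_dim_fin_dim[OF assms(1), of A] A assms(2) by auto
qed

lemma dim_psubset_fin_dim:
  assumes U: "fin_dim U" and V: "Real_Vector_Spaces.subspace V" and VU: "V \<subset> U"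
  shows "dim V < dim U"
proof -
  obtain A where A: "A \<subseteq> V" "independent A" "V \<subseteq> span A" "card A = dim V"
    by (rule basis_exists)
  obtain x where x: "x \<in> U" "x \<notin> V"
    using VU by auto
  have "span A = V"
    using A V by (simp add: span_minimal subset_antisym)
  then have ind: "independent (insert x A)"
    using A x by (simp add: independent_insert)
  have fin: "finite (insert x A)"
    using fin_dim_independent[OF U ind] A x VU by auto
  have "card (insert x A) = Suc (dim V)"
    using fin A x by (auto simp: card_insert_if)
  moreover have "insert x A \<subseteq> U"
    using A x VU by blast
  ultimately show ?thesis
    using independent_card_le_dim_fin_dim[OF U ind] by simp
qed

text \<open>The coefficients of \<open>x\<close> over \<open>B\<close> vanish outside
  \<open>A\<close> and outside \<open>C\<close>, hence everywhere.\<close>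

lemma span_Int_span_independent:
  fixes x :: "'a::real_vector"
  assumes "independent B" "A \<subseteq> B" "C \<subseteq> B" "A \<inter> C = {}" "x \<in> span A" "x \<in> span C"
  shows "x = 0"
proof -
  have "representation B x = representation A x" "representation B x = representation C x"
    using assms real_vector.representation_extend by blast+
  then have "representation B x b = 0" for b
    using assms(4) real_vector.representation_ne_zero[of A x b]
      real_vector.representation_ne_zero[of C x b] by auto
  moreover have "x \<in> span B"
    using assms span_mono by blast
  ultimately show ?thesis
    using real_vector.sum_nonzero_representation_eq[OF assms(1), of x] by simp
qed

text \<open>A basis \<open>A\<close> of the kernel extends to a basis \<open>B\<close> of
  \<open>U\<close>, and \<open>f\<close> carries \<open>B - A\<close> injectively to a basis of the
  image.\<close>

lemma rank_nullity:
  fixes f :: "'a::real_vector \<Rightarrow> 'b::real_vector"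
  assumes f: "linear f" and U: "Real_Vector_Spaces.subspace U" "fin_dim U"
  shows "dim U = dim (f ` U) + dim {u \<in> U. f u = 0}"
proof -
  let ?K = "{u \<in> U. f u = 0}"
  obtain A where A: "A \<subseteq> ?K" "independent A" "?K \<subseteq> span A" "card A = dim ?K"
    by (rule basis_exists)
  obtain B where B: "A \<subseteq> B" "B \<subseteq> U" "independent B" "U \<subseteq> span B"
    using maximal_independent_subset_extend[of A U] A by auto
  have fin: "finite B"
    using B U(2) by (metis fin_dim_independent)
  let ?C = "B - A"
  have spanU: "span B = U"
    using B U by (simp add: span_minimal subset_antisym)
  have kerA: "f x = 0" if "x \<in> span A" for x
    using that A(1) linear_eq_0_on_span[OF f] by blast
  have inj: "inj_on f (span ?C)"
  proof (subst linear_inj_on_iff_eq_0[OF f subspace_span], intro ballI impI)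
    fix x assume x: "x \<in> span ?C" "f x = 0"
    then have "x \<in> U"
      using spanU span_mono[of ?C B] by auto
    then have "x \<in> span A"
      using x A by auto
    then show "x = 0"
      using span_Int_span_independent[OF B(3,1), of ?C] x by auto
  qed
  have "independent ?C"
    using B(3) independent_mono by blast
  then have ind: "independent (f ` ?C)"
    using linear_independent_injective_image[OF f] inj by blast
  have "f ` U \<subseteq> span (f ` ?C)"
  proof
    fix y assume "y \<in> f ` U"
    then obtain u where u: "u \<in> span (A \<union> ?C)" "y = f u"
      using B by (auto simp: Un_absorb1)
    then obtain a c where "a \<in> span A" "c \<in> span ?C" "u = a + c"
      unfolding span_Un by blast
    then show "y \<in> span (f ` ?C)"
      using u kerA linear_add[OF f] linear_span_image[OF f] by auto
  qed
  then have "dim (f ` U) = card (f ` ?C)"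
    using basis_card_eq_dim[of "f ` ?C" "f ` U"] ind B by fastforce
  moreover have "card (f ` ?C) = card ?C"
    using inj span_superset by (metis card_image inj_on_subset)
  moreover have "card B = dim U"
    using basis_card_eq_dim B by blast
  moreover have "card ?C = card B - card A" "card A \<le> card B"
    using B(1) fin by (auto simp: card_Diff_subset finite_subset card_mono)
  ultimately show ?thesis
    using A(4) by simp
qed

lemma dim_singleton_0: "dim {0 :: 'a::real_vector} = 0"
  using dim_eq_card[of "{}" "{0 :: 'a}"] independent_empty by (simp add: span_singleton)

lemma dim_image_inj_fin_dim:
  fixes f :: "'a::real_vector \<Rightarrow> 'b::real_vector"
  assumes "linear f" "Real_Vector_Spaces.subspace U" "fin_dim U"
    and "\<And>u. u \<in> U \<Longrightarrow> f u = 0 \<Longrightarrow> u = 0"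
  shows "dim (f ` U) = dim U"
proof -
  have "{u \<in> U. f u = 0} = {0}"
    using assms by (auto simp: linear_0 subspace_0)
  then show ?thesis
    using rank_nullity[OF assms(1-3)] by (simp add: dim_singleton_0)
qed

section \<open>Coordinate subspaces, the copies of \<open>\<real>\<^sup>I\<close> inside the
  function space\<close>

definition supp_on :: "'i set \<Rightarrow> ('i \<Rightarrow> real) set" where
  "supp_on I = {u. \<forall>i. i \<notin> I \<longrightarrow> u i = 0}"

lemma subspace_supp_on: "Real_Vector_Spaces.subspace (supp_on I)"
  by (auto simp: subspace_def supp_on_def)

lemma basis_supp_on:
  fixes I :: "'i set"
  assumes "finite I"
  defines "D \<equiv> (\<lambda>i j. if j = i then 1 else 0 :: real) ` I"
  shows "independent D" "supp_on I \<subseteq> span D" "D \<subseteq> supp_on I" "card D = card I"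
proof -
  let ?d = "\<lambda>i j. if j = i then 1 else 0 :: real"
  have inj: "inj_on ?d I"
    by (rule inj_onI) (metis zero_neq_one)
  have eq: "(\<Sum>i\<in>I. c i *\<^sub>R ?d i) j = (if j \<in> I then c j else 0)" for c :: "'i \<Rightarrow> real" and j
  proof -
    have "(\<Sum>i\<in>I. c i *\<^sub>R ?d i) j = (\<Sum>i\<in>I. (c i *\<^sub>R ?d i) j)"
      using assms(1) by (induction I rule: finite_induct) auto
    also have "\<dots> = (\<Sum>i\<in>I. if j = i then c i else 0)"
      by (intro sum.cong) auto
    finally show ?thesis
      using assms(1) by simp
  qed
  show "card D = card I"
    using inj by (simp add: D_def card_image)
  show "D \<subseteq> supp_on I"
    by (auto simp: D_def supp_on_def)
  show "supp_on I \<subseteq> span D"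
  proof
    fix u assume u: "u \<in> supp_on I"
    have "u = (\<Sum>i\<in>I. u i *\<^sub>R ?d i)"
      using u by (auto simp: fun_eq_iff eq supp_on_def)
    also have "\<dots> \<in> span D"
      by (intro span_sum span_scale span_base) (auto simp: D_def)
    finally show "u \<in> span D" .
  qed
  show "independent D"
  proof (subst independent_explicit_finite_subsets, intro allI impI ballI)
    fix S :: "('i \<Rightarrow> real) set" and c v
    assume "S \<subseteq> D" "finite S" and 0: "(\<Sum>v\<in>S. c v *\<^sub>R v) = 0" and "v \<in> S"
    then obtain I' where I': "I' \<subseteq> I" "S = ?d ` I'"
      unfolding D_def by (auto elim: subset_imageE)
    obtain j where j: "j \<in> I'" "v = ?d j"
      using I' \<open>v \<in> S\<close> by auto
    have fin: "finite I'"
      using I' assms(1) finite_subset by blast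
    \<comment> \<open>Evaluating the relation at the index \<open>j\<close> isolates the coefficient
      of \<open>v\<close>.\<close>
    have "0 = (\<Sum>i\<in>I'. c (?d i) *\<^sub>R ?d i) j"
      using 0 inj I' by (subst (asm) I') (simp add: sum.reindex inj_on_subset)
    also have "\<dots> = (\<Sum>i\<in>I'. if j = i then c (?d i) else 0)"
      using fin by (induction I' rule: finite_induct) auto
    also have "\<dots> = c v"
      using j fin by simp
    finally show "c v = 0" by simp
  qed
qed

lemma fin_dim_supp_on: "finite I \<Longrightarrow> fin_dim (supp_on I)"
  unfolding fin_dim_def using basis_supp_on(2) by blast

lemma dim_supp_on:
  fixes I :: "'i set"
  assumes "finite I"
  shows "dim (supp_on I) = card I"
  using basis_card_eq_dim basis_supp_on[OF assms] by metis

text \<open>The form is positive definite on \<open>supp_on I\<close>, so \<open>P\<close> and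
  \<open>Q\<close> meet only in 0 and the union of their bases is independent.\<close>

lemma dim_orthogonal_le:
  fixes I :: "'i set"
  assumes I: "finite I" and P: "P \<subseteq> supp_on I" "Real_Vector_Spaces.subspace P"
    and Q: "Q \<subseteq> supp_on I" "Real_Vector_Spaces.subspace Q"
    and orth: "\<And>p q. p \<in> P \<Longrightarrow> q \<in> Q \<Longrightarrow> (\<Sum>i\<in>I. p i * q i) = 0"
  shows "dim P + dim Q \<le> card I"
proof -
  have fin: "fin_dim P" "fin_dim Q"
    using P Q fin_dim_subset fin_dim_supp_on[OF I] by blast+
  obtain A where A: "A \<subseteq> P" "independent A" "P \<subseteq> span A" "card A = dim P"
    by (rule basis_exists)
  have spanA: "span A = P"
    using A P by (simp add: span_minimal subset_antisym)
  let ?T = "{p + q | p q. p \<in> P \<and> q \<in> Q}"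
  obtain B where B: "B \<subseteq> Q" "independent B" "Q \<subseteq> span B" "card B = dim Q"
    by (rule basis_exists)
  have spanB: "span B = Q"
    using B Q by (simp add: span_minimal subset_antisym)
  have finAB: "finite A" "finite B"
    using A B fin by (metis fin_dim_independent)+
  have PQ: "p = 0" if "p \<in> P" "p \<in> Q" for p
  proof -
    have "(\<Sum>i\<in>I. p i * p i) = 0"
      using orth that by blast
    then have "\<forall>i\<in>I. p i * p i = 0"
      using I by (subst (asm) sum_nonneg_eq_0_iff) auto
    then show ?thesis
      using that(1) P(1) by (auto simp: supp_on_def fun_eq_iff)
  qed
  \<comment> \<open>Basis vectors of \<open>Q\<close> join \<open>A\<close> one at a time: if
    \<open>b = p + q\<close> with \<open>p\<close> in \<open>P\<close> and \<open>q\<close> in the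
    span of \<open>S\<close>, then \<open>p = b - q\<close> lies in both spaces and is 0, so
    \<open>b\<close> would depend on \<open>S\<close>.\<close>
  have ind: "independent (A \<union> S) \<and> A \<inter> S = {}" if "S \<subseteq> B" "finite S" for S
    using that(2,1)
  proof (induction S rule: finite_induct)
    case (insert b S)
    have "b \<notin> span (A \<union> S)"
    proof
      assume "b \<in> span (A \<union> S)"
      then obtain p q where pq: "p \<in> P" "q \<in> span S" "b = p + q"
        unfolding span_Un spanA by blast
      have "b \<in> Q" "q \<in> Q"
        using insert.prems pq(2) spanB span_mono[of S B] B by auto
      then have "b - q \<in> Q"
        using Q subspace_diff by blast
      then have "p = 0"
        using PQ pq by simp
      then have "b \<in> span S"
        using pq by simp
      then have "b \<in> span (B - {b})"
        using span_mono[of S "B - {b}"] insert by auto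
      then show False
        using B(2) insert.prems by (auto simp: dependent_def)
    qed
    moreover from this have "b \<notin> A"
      using span_base[of b "A \<union> S"] by blast
    ultimately show ?case
      using insert by (auto simp: independent_insert)
  qed (use A in simp)
  have "card (A \<union> B) \<le> dim (supp_on I)"
    using independent_card_le_dim_fin_dim[OF fin_dim_supp_on[OF I], of "A \<union> B"] ind[of B] finAB
      subset_trans[OF A(1) P(1)] subset_trans[OF B(1) Q(1)]
    by simp
  moreover have "card (A \<union> B) = card A + card B"
    using ind[of B] finAB by (simp add: card_Un_disjoint)
  ultimately show ?thesis
    using A B by (simp add: dim_supp_on[OF I])
qed

section \<open>Chains of kernels of diagonal forms\<close>

text \<open>The number of strict inclusions in the chain of successive zero sets. Stalling steps are
  allowed, since a chain restricted to a smaller subspace may stall.\<close>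

fun drops :: "('a \<Rightarrow> real) list \<Rightarrow> 'a set \<Rightarrow> nat" where
  "drops [] U = 0"
| "drops (g # gs) U = (if \<exists>u\<in>U. g u \<noteq> 0 then 1 else 0) + drops gs {u \<in> U. g u = 0}"

text \<open>The list holds the forms as functions and the coefficients \<open>y\<close> are only
  asserted to exist, so one list serves for several index sets and for smaller subspaces.\<close>

fun reduction :: "'i set \<Rightarrow> (('i \<Rightarrow> real) \<Rightarrow> real) list \<Rightarrow> ('i \<Rightarrow> real) set \<Rightarrow> bool" where
  "reduction I [] U \<longleftrightarrow> True"
| "reduction I (g # gs) U \<longleftrightarrow>
     (\<exists>y. \<forall>u\<in>U. g u = (\<Sum>i\<in>I. y i * (u i)\<^sup>2) \<and> (\<Sum>i\<in>I. y i * u i) = 0 \<and> 0 \<le> g u) \<and>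
     reduction I gs {u \<in> U. g u = 0}"

section \<open>Null vectors of semidefinite diagonal forms\<close>

lemma nonneg_quadratic_discriminant:
  fixes a b c :: real
  assumes "\<And>t. 0 \<le> a + 2 * t * b + t\<^sup>2 * c"
  shows "b\<^sup>2 \<le> a * c"
proof (cases "c = 0")
  case True
  show ?thesis
  proof (cases "b = 0")
    case False
    then show ?thesis
      \<comment> \<open>This \<open>t\<close> makes the expression equal to -1.\<close>
      using assms[of "- (a + 1) / (2 * b)"] True by (simp add: field_simps)
  qed (simp add: True)
next
  case False
  have "c > 0"
  proof (rule ccontr)
    assume "\<not> c > 0"
    then have c: "c < 0" using False by simp
    \<comment> \<open>At this \<open>t\<close>, which is at least 1, the quadratic term outweighs
      the other two and leaves at most \<open>t * c\<close>, which is negative.\<close>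
    define t where "t = (\<bar>a\<bar> + 2 * \<bar>b\<bar>) / (- c) + 1"
    have t: "t \<ge> 1" using c by (simp add: t_def divide_nonneg_neg)
    have "- c * t = \<bar>a\<bar> + 2 * \<bar>b\<bar> - c"
      using c by (simp add: t_def field_simps)
    then have "t * (- c * t) = t * (\<bar>a\<bar> + 2 * \<bar>b\<bar> - c)"
      by simp
    then have "t\<^sup>2 * c = - t * \<bar>a\<bar> - 2 * t * \<bar>b\<bar> + t * c"
      by (simp add: power2_eq_square algebra_simps)
    moreover have "t * c < 0" "a \<le> t * \<bar>a\<bar>" "t * b \<le> t * \<bar>b\<bar>"
      using t c mult_right_mono[of 1 t "\<bar>a\<bar>"] by (auto simp: mult_less_0_iff)
    ultimately show False
      using assms[of t] by (simp add: mult.assoc)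
  qed
  then show ?thesis
    \<comment> \<open>The parabola has its minimum here.\<close>
    using assms[of "- b / c"] by (simp add: field_simps power2_eq_square)
qed

text \<open>Along \<open>u + t v\<close> the form has no constant term, so nonnegativity for all
  \<open>t\<close> forces its linear coefficient to vanish.\<close>

lemma psd_diagonal_null_orthogonal:
  fixes U :: "('i \<Rightarrow> real) set"
  assumes U: "Real_Vector_Spaces.subspace U"
    and nn: "\<And>u. u \<in> U \<Longrightarrow> 0 \<le> (\<Sum>i\<in>I. y i * (u i)\<^sup>2)"
    and u: "u \<in> U" "(\<Sum>i\<in>I. y i * (u i)\<^sup>2) = 0" and v: "v \<in> U"
  shows "(\<Sum>i\<in>I. y i * u i * v i) = 0"
proof -
  have "0 \<le> 0 + 2 * t * (\<Sum>i\<in>I. y i * u i * v i) + t\<^sup>2 * (\<Sum>i\<in>I. y i * (v i)\<^sup>2)" for t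
  proof -
    have "u + t *\<^sub>R v \<in> U"
      using U u v by (simp add: subspace_add subspace_scale)
    then have "0 \<le> (\<Sum>i\<in>I. y i * ((u + t *\<^sub>R v) i)\<^sup>2)"
      by (rule nn)
    also have "\<dots> = (\<Sum>i\<in>I. y i * (u i)\<^sup>2 + 2 * t * (y i * u i * v i) + t\<^sup>2 * (y i * (v i)\<^sup>2))"
      by (intro sum.cong) (auto simp: power2_eq_square algebra_simps)
    finally show ?thesis
      using u by (simp add: sum.distrib sum_distrib_left)
  qed
  from nonneg_quadratic_discriminant[OF this] show ?thesis
    by simp
qed

text \<open>The cross term of two null vectors vanishes, which gives closure under addition.\<close>

lemma subspace_psd_diagonal_null:
  fixes U :: "('i \<Rightarrow> real) set"
  assumes U: "Real_Vector_Spaces.subspace U"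
    and nn: "\<And>u. u \<in> U \<Longrightarrow> 0 \<le> (\<Sum>i\<in>I. y i * (u i)\<^sup>2)"
  shows "Real_Vector_Spaces.subspace {u \<in> U. (\<Sum>i\<in>I. y i * (u i)\<^sup>2) = 0}"
proof (rule subspaceI)
  show "0 \<in> {u \<in> U. (\<Sum>i\<in>I. y i * (u i)\<^sup>2) = 0}"
    using U by (simp add: subspace_0)
next
  fix u v assume uv: "u \<in> {u \<in> U. (\<Sum>i\<in>I. y i * (u i)\<^sup>2) = 0}" "v \<in> {u \<in> U. (\<Sum>i\<in>I. y i * (u i)\<^sup>2) = 0}"
  have "(\<Sum>i\<in>I. y i * ((u + v) i)\<^sup>2) =
      (\<Sum>i\<in>I. y i * (u i)\<^sup>2 + 2 * (y i * u i * v i) + y i * (v i)\<^sup>2)"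
    by (intro sum.cong) (auto simp: power2_eq_square algebra_simps)
  also have "\<dots> = 0"
    using uv psd_diagonal_null_orthogonal[OF U nn, of u v]
    by (simp add: sum.distrib flip: sum_distrib_left)
  finally show "u + v \<in> {u \<in> U. (\<Sum>i\<in>I. y i * (u i)\<^sup>2) = 0}"
    using uv U by (simp add: subspace_add)
next
  fix c u assume u: "u \<in> {u \<in> U. (\<Sum>i\<in>I. y i * (u i)\<^sup>2) = 0}"
  have "(\<Sum>i\<in>I. y i * ((c *\<^sub>R u) i)\<^sup>2) = (\<Sum>i\<in>I. c\<^sup>2 * (y i * (u i)\<^sup>2))"
    by (intro sum.cong) (auto simp: power_mult_distrib)
  also have "\<dots> = 0"
    using u by (simp flip: sum_distrib_left)
  finally show "c *\<^sub>R u \<in> {u \<in> U. (\<Sum>i\<in>I. y i * (u i)\<^sup>2) = 0}"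
    using u U by (simp add: subspace_scale)
qed

lemma reduction_subspace:
  fixes U :: "('i \<Rightarrow> real) set"
  assumes "Real_Vector_Spaces.subspace U" "reduction I (g # gs) U"
  shows "Real_Vector_Spaces.subspace {u \<in> U. g u = 0}"
proof -
  obtain y where y: "\<forall>u\<in>U. g u = (\<Sum>i\<in>I. y i * (u i)\<^sup>2) \<and> 0 \<le> g u"
    using assms(2) by auto
  then have "{u \<in> U. g u = 0} = {u \<in> U. (\<Sum>i\<in>I. y i * (u i)\<^sup>2) = 0}"
    by auto
  moreover have "\<And>u. u \<in> U \<Longrightarrow> 0 \<le> (\<Sum>i\<in>I. y i * (u i)\<^sup>2)"
    using y by metis
  ultimately show ?thesis
    using subspace_psd_diagonal_null[OF assms(1), where I=I and y=y] by simp
qed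

text \<open>
  A strict inclusion in the chain of \<open>U\<close> persists in the chain of the kernel of \<open>\<phi>\<close> or else
  lowers the dimension of the image under \<open>\<phi>\<close>.
\<close>
lemma drops_le_drops_kernel:
  fixes U :: "('i \<Rightarrow> real) set" and \<phi> :: "('i \<Rightarrow> real) \<Rightarrow> 'b::real_vector"
  assumes "linear \<phi>" "Real_Vector_Spaces.subspace U" "fin_dim U" "reduction I gs U"
  shows "drops gs U \<le> drops gs {u \<in> U. \<phi> u = 0} + dim (\<phi> ` U)"
  using assms
proof (induction gs arbitrary: U)
  case (Cons g gs)
  define U' where "U' = {u \<in> U. g u = 0}"
  define K where "K = {u \<in> U. \<phi> u = 0}"
  have sub: "Real_Vector_Spaces.subspace U'"
    using reduction_subspace[OF Cons.prems(2,4)] by (simp add: U'_def)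
  have fd: "fin_dim U'" "fin_dim (\<phi> ` U)"
    using Cons.prems fin_dim_subset[of U' U] by (auto simp: U'_def fin_dim_image)
  have K': "{u \<in> K. g u = 0} = {u \<in> U'. \<phi> u = 0}"
    by (auto simp: K_def U'_def)
  have IH: "drops gs U' \<le> drops gs {u \<in> U'. \<phi> u = 0} + dim (\<phi> ` U')"
    using Cons.IH[OF Cons.prems(1) sub fd(1)] Cons.prems(4) by (simp add: U'_def)
  have le: "dim (\<phi> ` U') \<le> dim (\<phi> ` U)"
    by (rule dim_mono_fin_dim[OF fd(2)]) (auto simp: U'_def)
  \<comment> \<open>If the step is strict on \<open>U\<close> but stalls on \<open>K\<close>, then
    \<open>\<phi>\<close> has the same kernel on \<open>U'\<close> as on \<open>U\<close>, and by
    rank-nullity the whole loss of dimension falls on the image.\<close>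
  have lt: "dim (\<phi> ` U') < dim (\<phi> ` U)" if "\<exists>u\<in>U. g u \<noteq> 0" "\<not> (\<exists>u\<in>K. g u \<noteq> 0)"
  proof -
    have "K = {u \<in> U'. \<phi> u = 0}"
      using that(2) K' by blast
    moreover have "dim U' < dim U"
      using that(1) by (intro dim_psubset_fin_dim[OF Cons.prems(3) sub]) (auto simp: U'_def)
    ultimately show ?thesis
      using rank_nullity[OF Cons.prems(1-3)] rank_nullity[OF Cons.prems(1) sub fd(1)]
      by (simp add: K_def)
  qed
  have dU: "drops (g # gs) U = (if \<exists>u\<in>U. g u \<noteq> 0 then 1 else 0) + drops gs U'"
    by (simp add: U'_def)
  have dK: "drops (g # gs) K = (if \<exists>u\<in>K. g u \<noteq> 0 then 1 else 0) + drops gs {u \<in> U'. \<phi> u = 0}"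
    by (simp add: K')
  have KU: "\<exists>u\<in>U. g u \<noteq> 0" if "\<exists>u\<in>K. g u \<noteq> 0"
    using that by (auto simp: K_def)
  have "drops (g # gs) U \<le> drops (g # gs) K + dim (\<phi> ` U)"
  proof (cases "(\<exists>u\<in>U. g u \<noteq> 0) \<and> \<not> (\<exists>u\<in>K. g u \<noteq> 0)")
    case True
    then have "dim (\<phi> ` U') < dim (\<phi> ` U)"
      using lt by blast
    then show ?thesis
      unfolding dU dK using IH by simp
  next
    case False
    then have "(\<exists>u\<in>U. g u \<noteq> 0) = (\<exists>u\<in>K. g u \<noteq> 0)"
      using KU by blast
    then show ?thesis
      unfolding dU dK using IH le by simp
  qed
  then show ?case
    unfolding K_def .
next
  case Nil
  then show ?case
    by (simp only: drops.simps le0)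
qed

section \<open>Shrinking the subspace and changing the index set\<close>

lemma reduction_mono:
  "K \<subseteq> U \<Longrightarrow> reduction I gs U \<Longrightarrow> reduction I gs K"
proof (induction gs arbitrary: U K)
  case (Cons g gs)
  have "{u \<in> K. g u = 0} \<subseteq> {u \<in> U. g u = 0}"
    using Cons.prems(1) by blast
  then have "reduction I gs {u \<in> K. g u = 0}"
    using Cons.IH Cons.prems(2) by simp
  moreover obtain y where
    "\<forall>u\<in>U. g u = (\<Sum>i\<in>I. y i * (u i)\<^sup>2) \<and> (\<Sum>i\<in>I. y i * u i) = 0 \<and> 0 \<le> g u"
    using Cons.prems(2) unfolding reduction.simps by (elim conjE exE)
  then have "\<forall>u\<in>K. g u = (\<Sum>i\<in>I. y i * (u i)\<^sup>2) \<and> (\<Sum>i\<in>I. y i * u i) = 0 \<and> 0 \<le> g u"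
    using Cons.prems(1) by (meson subsetD)
  ultimately show ?case
    unfolding reduction.simps by (intro conjI exI)
qed simp

lemma reduction_reindex:
  assumes "reduction I gs K"
    and reindex: "\<And>y. \<exists>y'. \<forall>u\<in>K. (\<Sum>i\<in>I. y i * (u i)\<^sup>2) = (\<Sum>i\<in>I'. y' i * (u i)\<^sup>2) \<and>
                                  (\<Sum>i\<in>I. y i * u i) = (\<Sum>i\<in>I'. y' i * u i)"
  shows "reduction I' gs K"
proof -
  \<comment> \<open>The chain shrinks the subspace while \<open>reindex\<close> speaks of
    \<open>K\<close>, so the induction runs over all subsets of \<open>K\<close>.\<close>
  have *: "reduction I' gs V" if "reduction I gs V" "V \<subseteq> K" for V
    using that
  proof (induction gs arbitrary: V)
    case (Cons g gs)
    obtain y where y: "\<forall>u\<in>V. g u = (\<Sum>i\<in>I. y i * (u i)\<^sup>2) \<and> (\<Sum>i\<in>I. y i * u i) = 0 \<and> 0 \<le> g u"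
      using Cons.prems(1) unfolding reduction.simps by (elim conjE exE)
    obtain y' where y': "\<forall>u\<in>K. (\<Sum>i\<in>I. y i * (u i)\<^sup>2) = (\<Sum>i\<in>I'. y' i * (u i)\<^sup>2) \<and>
        (\<Sum>i\<in>I. y i * u i) = (\<Sum>i\<in>I'. y' i * u i)"
      using reindex[of y] by (elim exE)
    have "\<forall>u\<in>V. g u = (\<Sum>i\<in>I'. y' i * (u i)\<^sup>2) \<and> (\<Sum>i\<in>I'. y' i * u i) = 0 \<and> 0 \<le> g u"
    proof
      fix u assume u: "u \<in> V"
      from bspec[OF y u] bspec[OF y' subsetD[OF Cons.prems(2) u]]
      show "g u = (\<Sum>i\<in>I'. y' i * (u i)\<^sup>2) \<and> (\<Sum>i\<in>I'. y' i * u i) = 0 \<and> 0 \<le> g u"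
        by linarith
    qed
    moreover have "{u \<in> V. g u = 0} \<subseteq> K"
      using Cons.prems(2) by blast
    then have "reduction I' gs {u \<in> V. g u = 0}"
      using Cons.IH Cons.prems(1) by simp
    ultimately show ?case
      unfolding reduction.simps by (intro conjI exI)
  qed simp
  show ?thesis
    by (rule *[OF assms(1) subset_refl])
qed

lemma reduction_delete:
  fixes I :: "'i set"
  assumes "finite I" "B \<subseteq> I" "reduction I gs K" "\<And>u i. u \<in> K \<Longrightarrow> i \<in> B \<Longrightarrow> u i = 0"
  shows "reduction (I - B) gs K"
proof (rule reduction_reindex[OF assms(3)])
  fix y :: "'i \<Rightarrow> real"
  have "(\<Sum>i\<in>I. y i * (u i)\<^sup>2) = (\<Sum>i\<in>I - B. y i * (u i)\<^sup>2) \<and>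
      (\<Sum>i\<in>I. y i * u i) = (\<Sum>i\<in>I - B. y i * u i)" if "u \<in> K" for u
    using assms that by (intro conjI sum.mono_neutral_right) auto
  then show "\<exists>y'. \<forall>u\<in>K. (\<Sum>i\<in>I. y i * (u i)\<^sup>2) = (\<Sum>i\<in>I - B. y' i * (u i)\<^sup>2) \<and>
      (\<Sum>i\<in>I. y i * u i) = (\<Sum>i\<in>I - B. y' i * u i)"
    by (intro exI[of _ y] ballI)
qed

lemma reduction_merge:
  fixes I :: "'i set"
  assumes "finite I" "B \<subseteq> I" "b \<in> B" "reduction I gs K" "\<And>u i. u \<in> K \<Longrightarrow> i \<in> B \<Longrightarrow> u i = u b"
  shows "reduction (insert b (I - B)) gs K"
proof (rule reduction_reindex[OF assms(4)])
  fix y :: "'i \<Rightarrow> real"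
  \<comment> \<open>The merged coordinate \<open>b\<close> carries the total weight of
    \<open>B\<close>.\<close>
  define y' where "y' i = (if i = b then sum y B else y i)" for i
  \<comment> \<open>A general \<open>f\<close> covers the quadratic and the linear form at
    once.\<close>
  have eq: "(\<Sum>i\<in>I. y i * f (u i)) = (\<Sum>i\<in>insert b (I - B). y' i * f (u i))"
    if "u \<in> K" for u and f :: "real \<Rightarrow> real"
  proof -
    have "(\<Sum>i\<in>I. y i * f (u i)) = (\<Sum>i\<in>I - B. y i * f (u i)) + (\<Sum>i\<in>B. y i * f (u i))"
      using assms(1,2) by (rule sum.subset_diff[rotated])
    also have "(\<Sum>i\<in>B. y i * f (u i)) = (\<Sum>i\<in>B. y i * f (u b))"
      using assms(5)[OF that] by (intro sum.cong) simp_all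
    also have "\<dots> = y' b * f (u b)"
      by (simp add: y'_def sum_distrib_right)
    also have "(\<Sum>i\<in>I - B. y i * f (u i)) = (\<Sum>i\<in>I - B. y' i * f (u i))"
      using assms(3) by (intro sum.cong) (auto simp: y'_def)
    finally show ?thesis
      using assms(1,3) by simp
  qed
  show "\<exists>y'. \<forall>u\<in>K. (\<Sum>i\<in>I. y i * (u i)\<^sup>2) = (\<Sum>i\<in>insert b (I - B). y' i * (u i)\<^sup>2) \<and>
      (\<Sum>i\<in>I. y i * u i) = (\<Sum>i\<in>insert b (I - B). y' i * u i)"
    by (intro exI[of _ y'] ballI conjI eq[where f="\<lambda>x. x\<^sup>2"] eq[where f="\<lambda>x. x"])
qed

section \<open>The dimension count on the support of the first form\<close>

definition restrict_fun :: "'i set \<Rightarrow> ('i \<Rightarrow> real) \<Rightarrow> 'i \<Rightarrow> real" where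
  "restrict_fun B u = (\<lambda>i. if i \<in> B then u i else 0)"

lemma linear_restrict_fun: "linear (restrict_fun B)"
  by (rule linearI) (auto simp: restrict_fun_def fun_eq_iff)

lemma restrict_fun_supp_on: "restrict_fun B u \<in> supp_on B"
  by (simp add: restrict_fun_def supp_on_def)

lemma subspace_linear_kernel:
  assumes "linear f" "Real_Vector_Spaces.subspace U"
  shows "Real_Vector_Spaces.subspace {u \<in> U. f u = 0}"
  by (rule subspaceI)
    (simp_all add: assms subspace_0 subspace_add subspace_scale linear_0 linear_add linear_scale)

text \<open>
  \<open>U\<close> lives on the larger index set \<open>J\<close> but is determined by its coordinates in \<open>I\<close>, so that the
  induction can discard or merge coordinates without changing the ambient space.
\<close>
lemma drops_add_dim_le_card:
  fixes U :: "('i \<Rightarrow> real) set"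
  assumes "finite J" "I \<subseteq> J" "Real_Vector_Spaces.subspace U" "U \<subseteq> supp_on J"
    and "\<And>u. u \<in> U \<Longrightarrow> (\<And>i. i \<in> I \<Longrightarrow> u i = 0) \<Longrightarrow> u = 0"
    and "reduction I gs U"
  shows "drops gs U + dim U \<le> card I"
  using assms(2-)
proof (induction "card I + length gs" arbitrary: I gs U rule: less_induct)
  case less
  have fin: "finite I"
    using less.prems(1) assms(1) finite_subset by blast
  have fdU: "fin_dim U"
    using less.prems(3) fin_dim_supp_on[OF assms(1)] fin_dim_subset by blast
  show ?case
  proof (cases gs)
    case Nil
    \<comment> \<open>With no form left, it remains that \<open>U\<close> embeds into
      \<open>supp_on I\<close>.\<close>
    have "dim U = dim (restrict_fun I ` U)"
      using less.prems(4)
      by (intro dim_image_inj_fin_dim[symmetric] linear_restrict_fun less.prems(2) fdU)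
        (auto simp: restrict_fun_def fun_eq_iff split: if_splits)
    also have "\<dots> \<le> dim (supp_on I)"
      using fin by (intro dim_mono_fin_dim fin_dim_supp_on) (auto simp: restrict_fun_supp_on)
    finally show ?thesis
      using Nil fin by (simp add: dim_supp_on)
  next
    case (Cons g gs')
    define U1 where "U1 = {u \<in> U. g u = 0}"
    have red1: "reduction I gs' U1"
      using less.prems(5) Cons by (simp add: U1_def)
    have sub1: "Real_Vector_Spaces.subspace U1"
      using reduction_subspace[OF less.prems(2)] less.prems(5) Cons by (simp add: U1_def)
    have fd1: "fin_dim U1"
      using fdU fin_dim_subset[of U1 U] by (auto simp: U1_def)
    show ?thesis
    proof (cases "\<exists>u\<in>U. g u \<noteq> 0")
      case False
      then have "U1 = U" "drops gs U = drops gs' U1"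
        using Cons by (auto simp: U1_def)
      then show ?thesis
        using less.hyps[of I gs' U] less.prems red1 Cons by simp
    next
      case True
      then have drops: "drops gs U = 1 + drops gs' U1"
        using Cons by (simp add: U1_def)
      obtain y where y: "\<And>u. u \<in> U \<Longrightarrow> g u = (\<Sum>i\<in>I. y i * (u i)\<^sup>2)"
        "\<And>u. u \<in> U \<Longrightarrow> (\<Sum>i\<in>I. y i * u i) = 0" "\<And>u. u \<in> U \<Longrightarrow> 0 \<le> g u"
        using less.prems(5) unfolding Cons reduction.simps by blast
      define B where "B = {i \<in> I. y i \<noteq> 0}"
      have BI: "B \<subseteq> I" and finB: "finite B"
        using fin by (auto simp: B_def)
      have sumB: "(\<Sum>i\<in>I. y i * f i) = (\<Sum>i\<in>B. y i * f i)" for f :: "'i \<Rightarrow> real"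
        using fin by (intro sum.mono_neutral_right) (auto simp: B_def)
      have gB: "g u = (\<Sum>i\<in>B. y i * (u i)\<^sup>2)" and lB: "(\<Sum>i\<in>B. y i * u i) = 0" if "u \<in> U" for u
        using y(1,2)[OF that] by (simp_all add: sumB)
      \<comment> \<open>Null vectors of the form on \<open>U\<close> are orthogonal to all of
        \<open>U\<close> with respect to the weights \<open>y\<close>.\<close>
      have orth: "(\<Sum>i\<in>B. y i * u i * v i) = 0" if "u \<in> U1" "v \<in> U" for u v
        using that gB y(3)
        by (intro psd_diagonal_null_orthogonal[OF less.prems(2)]) (auto simp: U1_def)
      define N where "N = {u \<in> U. restrict_fun B u = 0}"
      have zeroB: "restrict_fun B u = 0 \<longleftrightarrow> (\<forall>i\<in>B. u i = 0)" for u
        by (auto simp: restrict_fun_def fun_eq_iff)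
      \<comment> \<open>Vanishing on \<open>B\<close> makes \<open>g\<close> vanish, so the kernel
        of the restriction already lies in \<open>U1\<close>.\<close>
      have N1: "N = {u \<in> U1. restrict_fun B u = 0}"
        using gB by (auto simp: N_def U1_def zeroB)
      have subN: "Real_Vector_Spaces.subspace N"
        unfolding N_def by (rule subspace_linear_kernel[OF linear_restrict_fun less.prems(2)])
      define P where "P = restrict_fun B ` U"
      have dimU: "dim U = dim P + dim N"
        unfolding P_def N_def by (rule rank_nullity[OF linear_restrict_fun less.prems(2) fdU])
      have subP: "Real_Vector_Spaces.subspace P"
        unfolding P_def by (rule linear_subspace_image[OF linear_restrict_fun less.prems(2)])
      define one where "one = restrict_fun B (\<lambda>_. 1)"
      \<comment> \<open>\<open>W\<close> contains the constant \<open>1\<close> besides \<open>\<phi> U\<^sub>1\<close>, which gives the spare dimension in \<open>key\<close>\<close>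
      define W where "W = {w \<in> supp_on B. \<forall>u\<in>U. (\<Sum>i\<in>B. y i * w i * u i) = 0}"
      have subW: "Real_Vector_Spaces.subspace W"
      proof (rule subspaceI)
        show "0 \<in> W"
          by (simp add: W_def supp_on_def)
        show "v + w \<in> W" if "v \<in> W" "w \<in> W" for v w
        proof -
          have "(\<Sum>i\<in>B. y i * (v + w) i * u i) = (\<Sum>i\<in>B. y i * v i * u i) + (\<Sum>i\<in>B. y i * w i * u i)" for u
            unfolding sum.distrib[symmetric] by (intro sum.cong) (auto simp: algebra_simps)
          then show ?thesis
            using that by (simp add: W_def supp_on_def)
        qed
        show "c *\<^sub>R w \<in> W" if "w \<in> W" for c w
        proof -
          have "(\<Sum>i\<in>B. y i * (c *\<^sub>R w) i * u i) = c * (\<Sum>i\<in>B. y i * w i * u i)" for u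
            unfolding sum_distrib_left by (intro sum.cong) auto
          then show ?thesis
            using that by (simp add: W_def supp_on_def)
        qed
      qed
      have oneW: "one \<in> W"
        using lB by (auto simp: W_def one_def restrict_fun_supp_on) (simp add: restrict_fun_def)
      have fdW: "fin_dim W"
        using finB fin_dim_supp_on fin_dim_subset[of W "supp_on B"] by (auto simp: W_def)
      \<comment> \<open>Multiplication by \<open>y\<close> is injective on \<open>W\<close>, as
        \<open>y\<close> has no zero on \<open>B\<close>, and it sends \<open>W\<close> into the
        orthogonal complement of \<open>P\<close>; hence the bound \<open>dimW\<close>.\<close>
      define m where "m = (\<lambda>w i. y i * restrict_fun B w i)"
      have linm: "linear m"
        by (rule linearI) (auto simp: m_def fun_eq_iff restrict_fun_def algebra_simps)
      have "dim (m ` W) = dim W"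
        by (rule dim_image_inj_fin_dim[OF linm subW fdW])
          (auto simp: m_def fun_eq_iff W_def supp_on_def restrict_fun_def B_def split: if_splits)
      moreover have "dim P + dim (m ` W) \<le> card B"
      proof (rule dim_orthogonal_le[OF finB _ subP])
        show "P \<subseteq> supp_on B" "m ` W \<subseteq> supp_on B"
          by (auto simp: P_def restrict_fun_supp_on m_def supp_on_def restrict_fun_def)
        show "Real_Vector_Spaces.subspace (m ` W)"
          by (rule linear_subspace_image[OF linm subW])
        fix p q assume "p \<in> P" "q \<in> m ` W"
        then obtain u w where "u \<in> U" "w \<in> W" "p = restrict_fun B u" "q = m w"
          by (auto simp: P_def)
        then show "(\<Sum>i\<in>B. p i * q i) = 0"
          by (auto simp: W_def m_def restrict_fun_def algebra_simps)
      qed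
      ultimately have dimW: "dim W + dim P \<le> card B"
        by simp
      \<comment> \<open>The image of \<open>U1\<close> is a subspace of \<open>W\<close> that misses
        \<open>one\<close>, so it has dimension at most \<open>dim W - 1\<close>.\<close>
      have key: "dim (\<phi> ` U1) + 1 + dim P \<le> card B"
        if "linear \<phi>" "\<phi> ` U1 \<subseteq> W" "one \<notin> \<phi> ` U1" for \<phi> :: "('i \<Rightarrow> real) \<Rightarrow> 'i \<Rightarrow> real"
      proof -
        have "\<phi> ` U1 \<subset> W"
          using that oneW by blast
        then have "dim (\<phi> ` U1) < dim W"
          using dim_psubset_fin_dim[OF fdW linear_subspace_image[OF that(1) sub1]] by blast
        then show ?thesis
          using dimW by simp
      qed
      have UJ: "U1 \<subseteq> supp_on J"
        using less.prems(3) by (auto simp: U1_def)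
      have cardB: "card (I - B) + card B = card I"
        using BI fin by (simp add: card_Diff_subset finB card_mono)
      show ?thesis
      proof (cases "one \<in> restrict_fun B ` U1")
        \<comment> \<open>Here \<open>key\<close> applies to the restriction to \<open>B\<close>,
          and its kernel \<open>N\<close> is left to the induction on \<open>I - B\<close>.\<close>
        case False
        have "restrict_fun B ` U1 \<subseteq> W"
          using orth by (auto simp: W_def restrict_fun_supp_on) (simp add: restrict_fun_def)
        then have "dim (restrict_fun B ` U1) + 1 + dim P \<le> card B"
          by (rule key[OF linear_restrict_fun _ False])
        moreover have "drops gs' U1 \<le> drops gs' N + dim (restrict_fun B ` U1)"
          unfolding N1 by (rule drops_le_drops_kernel[OF linear_restrict_fun sub1 fd1 red1])
        moreover have "drops gs' N + dim N \<le> card (I - B)"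
        proof (rule less.hyps)
          show "card (I - B) + length gs' < card I + length gs"
            using Cons cardB by simp
          show "Real_Vector_Spaces.subspace N"
            by (rule subN)
          show "reduction (I - B) gs' N"
            using N1 zeroB
            by (intro reduction_delete[OF fin BI reduction_mono[OF _ red1]]) auto
          show "u = 0" if "u \<in> N" "\<And>i. i \<in> I - B \<Longrightarrow> u i = 0" for u
            using that less.prems(4)[of u] by (auto simp: N_def zeroB)
        qed (use less.prems N_def in auto)
        \<comment> \<open>The 1 gained in \<open>key\<close> pays for the first strict
          inclusion.\<close>
        ultimately show ?thesis
          using drops dimU cardB by linarith
      next
        case one: True
        have "B \<noteq> {}"
          using True gB by auto
        then obtain b where b: "b \<in> B" by auto
        \<comment> \<open>Subtracting the entry at a reference index makes the kernel the vectors
          constant on \<open>B\<close>; every image vanishes at \<open>b\<close>, where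
          \<open>one\<close> is 1.\<close>
        define \<phi> where "\<phi> = (\<lambda>u :: 'i \<Rightarrow> real. restrict_fun B (\<lambda>i. u i - u b))"
        have lin: "linear \<phi>"
          by (rule linearI) (auto simp: \<phi>_def restrict_fun_def fun_eq_iff algebra_simps)
        define K where "K = {u \<in> U1. \<phi> u = 0}"
        have zero\<phi>: "\<phi> u = 0 \<longleftrightarrow> (\<forall>i\<in>B. u i = u b)" for u
          by (auto simp: restrict_fun_def fun_eq_iff \<phi>_def)
        \<comment> \<open>\<open>W\<close> contains \<open>one\<close> and the restrictions of
          vectors in \<open>U1\<close> to \<open>B\<close>, and \<open>\<phi> u\<close> is a
          combination of these.\<close>
        have "\<phi> ` U1 \<subseteq> W"
        proof
          fix w assume "w \<in> \<phi> ` U1"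
          then obtain u where u: "u \<in> U1" "w = \<phi> u" by auto
          have "(\<Sum>i\<in>B. y i * w i * v i) = 0" if "v \<in> U" for v
          proof -
            have "(\<Sum>i\<in>B. y i * w i * v i) = (\<Sum>i\<in>B. y i * u i * v i) - u b * (\<Sum>i\<in>B. y i * v i)"
              unfolding sum_distrib_left sum_subtractf[symmetric]
              by (intro sum.cong) (auto simp: u(2) \<phi>_def restrict_fun_def algebra_simps)
            then show ?thesis
              using lB[OF that] orth[OF u(1) that] by simp
          qed
          then show "w \<in> W"
            by (auto simp: W_def u(2) \<phi>_def restrict_fun_supp_on)
        qed
        moreover have "one \<notin> \<phi> ` U1"
        proof
          assume "one \<in> \<phi> ` U1"
          then obtain u where "one b = \<phi> u b" by auto
          then show False
            using b by (simp add: one_def \<phi>_def restrict_fun_def)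
        qed
        ultimately have "dim (\<phi> ` U1) + 1 + dim P \<le> card B"
          by (rule key[OF lin])
        moreover have "drops gs' U1 \<le> drops gs' K + dim (\<phi> ` U1)"
          unfolding K_def by (rule drops_le_drops_kernel[OF lin sub1 fd1 red1])
        moreover have subK: "Real_Vector_Spaces.subspace K"
          unfolding K_def by (rule subspace_linear_kernel[OF lin sub1])
        moreover have "drops gs' K + dim K \<le> card (insert b (I - B))"
        proof (rule less.hyps)
          \<comment> \<open>If \<open>B\<close> is a singleton, the index set keeps its size and
            only the list gets shorter.\<close>
          show "card (insert b (I - B)) + length gs' < card I + length gs"
            using Cons cardB b fin finB card_gt_0_iff[of B] \<open>B \<noteq> {}\<close> by (simp add: card_insert_if)
          show "reduction (insert b (I - B)) gs' K"
            using zero\<phi>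
            by (intro reduction_merge[OF fin BI b reduction_mono[OF _ red1]]) (auto simp: K_def)
          show "u = 0" if "u \<in> K" "\<And>i. i \<in> insert b (I - B) \<Longrightarrow> u i = 0" for u
            using that less.prems(4)[of u] by (auto simp: K_def U1_def zero\<phi>)
          show "insert b (I - B) \<subseteq> J"
            using b BI less.prems(1) by auto
        qed (use subK UJ K_def in auto)
        moreover have "card (insert b (I - B)) = card (I - B) + 1"
          using b fin by simp
        \<comment> \<open>A vector equal to 1 on \<open>B\<close> lies in \<open>K\<close> but not
          in \<open>N\<close>; this dimension makes up for the extra index \<open>b\<close>.\<close>
        moreover have "dim N < dim K"
        proof (rule dim_psubset_fin_dim)
          show "fin_dim K"
            using fd1 fin_dim_subset[of K U1] by (auto simp: K_def)
          show "Real_Vector_Spaces.subspace N"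
            by (rule subN)
          obtain u where u: "u \<in> U1" "one = restrict_fun B u"
            using one by auto
          then have "u i = 1" if "i \<in> B" for i
            using that u(2) unfolding one_def restrict_fun_def by (metis (full_types))
          then have "u \<in> K" "u \<notin> N"
            using u b by (auto simp: K_def zero\<phi> N_def zeroB)
          moreover have "N \<subseteq> K"
            using b by (auto simp: N1 K_def zero\<phi> zeroB)
          ultimately show "N \<subset> K" by blast
        qed
        ultimately show ?thesis
          using drops dimU cardB by linarith
      qed
    qed
  qed
qed

lemma drops_zero:
  fixes I :: "'i set"
  shows "reduction I gs {0} \<Longrightarrow> drops gs {0} = 0"
proof (induction gs)
  case (Cons g gs)
  obtain y where "g 0 = (\<Sum>i\<in>I. y i * ((0 :: 'i \<Rightarrow> real) i)\<^sup>2)"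
    using Cons.prems unfolding reduction.simps by blast
  then have g0: "g 0 = 0"
    by simp
  then have "{u \<in> {0}. g u = 0} = {0}"
    by blast
  then show ?case
    using Cons g0 by (simp only: drops.simps reduction.simps) simp
qed simp

text \<open>This is \<open>drops_le_drops_kernel\<close> for \<open>id\<close>, whose kernel
  \<open>{0}\<close> admits no strict inclusion.\<close>

lemma drops_le_dim:
  fixes U :: "('i \<Rightarrow> real) set"
  assumes "Real_Vector_Spaces.subspace U" "fin_dim U" "reduction I gs U"
  shows "drops gs U \<le> dim U"
proof -
  have ker: "{u \<in> U. id u = 0} = {0}"
    using assms(1) by (auto simp: subspace_0)
  have red: "reduction I gs {0}"
    using reduction_mono[OF _ assms(3), of "{0}"] assms(1) by (simp add: subspace_0)
  have "drops gs U \<le> drops gs {u \<in> U. id u = 0} + dim (id ` U)"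
    by (rule drops_le_drops_kernel[OF linear_id assms])
  then show ?thesis
    unfolding ker drops_zero[OF red] by simp
qed

section \<open>Positive semidefinite matrices and rank-one matrices\<close>

text \<open>\<open>comb x c y\<close> stands for \<open>x - c y\<close>, which covers matrices of a
  fixed size. By induction \<open>f\<close> has the required form on the kernel of the last
  functional, and one point off that kernel fixes the last coefficient.\<close>

lemma functional_in_span:
  fixes f :: "'x \<Rightarrow> real" and g :: "nat \<Rightarrow> 'x \<Rightarrow> real"
  assumes "\<And>x y c. x \<in> S \<Longrightarrow> y \<in> S \<Longrightarrow> comb x c y \<in> S"
    and "\<And>x y c. x \<in> S \<Longrightarrow> y \<in> S \<Longrightarrow> f (comb x c y) = f x - c * f y"
    and "\<And>x y c i. x \<in> S \<Longrightarrow> y \<in> S \<Longrightarrow> g i (comb x c y) = g i x - c * g i y"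
    and "\<And>x. x \<in> S \<Longrightarrow> (\<And>i. i < n \<Longrightarrow> g i x = 0) \<Longrightarrow> f x = 0"
  shows "\<exists>a. \<forall>x\<in>S. f x = (\<Sum>i<n. a i * g i x)"
  using assms
proof (induction n arbitrary: S)
  case (Suc n)
  define S' where "S' = {x \<in> S. g n x = 0}"
  have "\<exists>a. \<forall>x\<in>S'. f x = (\<Sum>i<n. a i * g i x)"
  proof (rule Suc.IH)
    show "f x = 0" if "x \<in> S'" "\<And>i. i < n \<Longrightarrow> g i x = 0" for x
      using that Suc.prems(4)[of x] by (auto simp: S'_def less_Suc_eq)
  qed (use Suc.prems S'_def in auto)
  then obtain a where a: "\<And>x. x \<in> S' \<Longrightarrow> f x = (\<Sum>i<n. a i * g i x)"
    by blast
  show ?case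
  proof (cases "\<exists>z\<in>S. g n z \<noteq> 0")
    case False
    then have "f x = (\<Sum>i<Suc n. a i * g i x)" if "x \<in> S" for x
      using that a[of x] by (simp add: S'_def)
    then show ?thesis
      by blast
  next
    case True
    then obtain z where z: "z \<in> S" "g n z \<noteq> 0"
      by blast
    \<comment> \<open>Forced by the required equation at \<open>z\<close>.\<close>
    define b where "b = (f z - (\<Sum>i<n. a i * g i z)) / g n z"
    define a' where "a' = a(n := b)"
    have "f x = (\<Sum>i<Suc n. a' i * g i x)" if x: "x \<in> S" for x
    proof -
      \<comment> \<open>Chosen so that \<open>g n\<close> vanishes at
        \<open>comb x c z\<close>.\<close>
      define c where "c = g n x / g n z"
      have "comb x c z \<in> S'"
        using x z Suc.prems(1,3) by (simp add: S'_def c_def)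
      from a[OF this] have "f x - c * f z = (\<Sum>i<n. a i * (g i x - c * g i z))"
        by (simp add: Suc.prems(2,3) x z)
      also have "\<dots> = (\<Sum>i<n. a i * g i x) - c * (\<Sum>i<n. a i * g i z)"
        by (simp add: algebra_simps sum_subtractf sum_distrib_left)
      finally have "f x = (\<Sum>i<n. a i * g i x) + c * (f z - (\<Sum>i<n. a i * g i z))"
        by (simp add: algebra_simps)
      also have "c * (f z - (\<Sum>i<n. a i * g i z)) = b * g n x"
        by (simp add: b_def c_def)
      also have "(\<Sum>i<n. a i * g i x) = (\<Sum>i<n. a' i * g i x)"
        by (intro sum.cong) (auto simp: a'_def)
      finally show ?thesis
        by (simp add: a'_def)
    qed
    then show ?thesis
      by blast
  qed
qed (auto)

section \<open>Trace inner product, quadratic forms and rank-one matrices\<close>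

lemma mat_inner_eq_sum:
  assumes "X \<in> carrier_mat p p" "Y \<in> carrier_mat p p"
  shows "mat_inner X Y = (\<Sum>i<p. \<Sum>j<p. X $$ (i, j) * Y $$ (j, i))"
  using assms by (auto simp: mat_inner_def mat_trace_def scalar_prod_def atLeast0LessThan intro!: sum.cong)

lemma mat_inner_commute:
  assumes "X \<in> carrier_mat p p" "Y \<in> carrier_mat p p"
  shows "mat_inner X Y = mat_inner Y X"
  unfolding mat_inner_eq_sum[OF assms] mat_inner_eq_sum[OF assms(2,1)]
  by (subst sum.swap) (simp add: mult.commute)

lemma mat_inner_add_right:
  assumes "X \<in> carrier_mat p p" "Y \<in> carrier_mat p p" "Z \<in> carrier_mat p p"
  shows "mat_inner X (Y + Z) = mat_inner X Y + mat_inner X Z"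
  using assms by (simp add: mat_inner_eq_sum[where p=p] algebra_simps sum.distrib)

lemma mat_inner_smult_right:
  assumes "X \<in> carrier_mat p p" "Y \<in> carrier_mat p p"
  shows "mat_inner X (c \<cdot>\<^sub>m Y) = c * mat_inner X Y"
  using assms by (simp add: mat_inner_eq_sum[where p=p] sum_distrib_left algebra_simps)

lemma sym_matsD:
  assumes "X \<in> sym_mats p"
  shows "X \<in> carrier_mat p p" "i < p \<Longrightarrow> j < p \<Longrightarrow> X $$ (i, j) = X $$ (j, i)"
proof -
  show X: "X \<in> carrier_mat p p"
    using assms by (simp add: sym_mats_def)
  assume "i < p" "j < p"
  then have "transpose_mat X $$ (i, j) = X $$ (j, i)"
    using X by simp
  then show "X $$ (i, j) = X $$ (j, i)"
    using assms by (simp add: sym_mats_def)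
qed

lemma sym_matsI:
  assumes "X \<in> carrier_mat p p" "\<And>i j. i < p \<Longrightarrow> j < p \<Longrightarrow> X $$ (i, j) = X $$ (j, i)"
  shows "X \<in> sym_mats p"
  using assms unfolding sym_mats_def by (auto intro!: eq_matI)

definition bilin :: "nat \<Rightarrow> real mat \<Rightarrow> (nat \<Rightarrow> real) \<Rightarrow> (nat \<Rightarrow> real) \<Rightarrow> real" where
  "bilin p X x y = (\<Sum>i<p. \<Sum>j<p. x i * X $$ (i, j) * y j)"

lemma bilin_eq_scalar_prod:
  assumes "X \<in> carrier_mat p p"
  shows "vec p x \<bullet> (X *\<^sub>v vec p y) = bilin p X x y"
  using assms by (auto simp: bilin_def scalar_prod_def sum_distrib_left atLeast0LessThan mult.assoc
    intro!: sum.cong)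

lemma psd_cone_iff:
  "X \<in> psd_cone p \<longleftrightarrow> X \<in> sym_mats p \<and> (\<forall>x. 0 \<le> bilin p X x x)"
proof (cases "X \<in> sym_mats p")
  case True
  note X = sym_matsD(1)[OF True]
  have "(\<forall>v\<in>carrier_vec p. 0 \<le> v \<bullet> (X *\<^sub>v v)) \<longleftrightarrow> (\<forall>x. 0 \<le> bilin p X x x)"
  proof (intro iffI allI ballI)
    fix x assume "\<forall>v\<in>carrier_vec p. 0 \<le> v \<bullet> (X *\<^sub>v v)"
    then show "0 \<le> bilin p X x x"
      using bilin_eq_scalar_prod[OF X, of x x] by (metis vec_carrier)
  next
    fix v :: "real vec" assume "\<forall>x. 0 \<le> bilin p X x x" "v \<in> carrier_vec p"
    moreover have "vec p (\<lambda>i. v $ i) = v"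
      using \<open>v \<in> carrier_vec p\<close> by auto
    ultimately show "0 \<le> v \<bullet> (X *\<^sub>v v)"
      using bilin_eq_scalar_prod[OF X, of "\<lambda>i. v $ i" "\<lambda>i. v $ i"] by simp
  qed
  then show ?thesis
    using True by (simp add: psd_cone_def)
qed (simp add: psd_cone_def)

definition outer :: "nat \<Rightarrow> (nat \<Rightarrow> real) \<Rightarrow> real mat" where
  "outer p x = mat p p (\<lambda>(i, j). x i * x j)"

lemma outer_index [simp]: "i < p \<Longrightarrow> j < p \<Longrightarrow> outer p x $$ (i, j) = x i * x j"
  by (simp add: outer_def)

lemma outer_carrier [simp]: "outer p x \<in> carrier_mat p p"
  by (simp add: outer_def)

lemma outer_dim [simp]: "dim_row (outer p x) = p" "dim_col (outer p x) = p"
  by (simp_all add: outer_def)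

lemma outer_sym: "outer p x \<in> sym_mats p"
  by (rule sym_matsI) auto

lemma bilin_outer: "bilin p (outer p x) y y = (\<Sum>i<p. x i * y i)\<^sup>2"
  unfolding bilin_def power2_eq_square sum_product by (intro sum.cong) auto

lemma outer_psd: "outer p x \<in> psd_cone p"
  by (simp add: psd_cone_iff outer_sym bilin_outer)

lemma mat_inner_outer:
  assumes "X \<in> carrier_mat p p"
  shows "mat_inner X (outer p x) = bilin p X x x"
  using assms by (auto simp: mat_inner_eq_sum[of _ p] bilin_def intro!: sum.cong)

lemma bilin_commute:
  assumes "X \<in> sym_mats p"
  shows "bilin p X x y = bilin p X y x"
  unfolding bilin_def
  by (subst sum.swap) (intro sum.cong refl, simp add: sym_matsD(2)[OF assms] mult_ac)

section \<open>Cauchy-Schwarz and deflation\<close>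

lemma sum_mult_delta:
  fixes f :: "nat \<Rightarrow> real"
  assumes "k < p"
  shows "(\<Sum>j<p. f j * (if j = k then 1 else 0)) = f k"
proof -
  have "(\<Sum>j<p. f j * (if j = k then 1 else 0)) = (\<Sum>j<p. if j = k then f j else 0)"
    by (intro sum.cong) auto
  then show ?thesis
    using assms by simp
qed

text \<open>Cauchy-Schwarz for the form of \<open>Z\<close>, at the \<open>k\<close>-th unit vector
  and \<open>x\<close>.\<close>

lemma psd_row_bound:
  assumes Z: "Z \<in> psd_cone p" and k: "k < p"
  shows "(\<Sum>j<p. Z $$ (k, j) * x j)\<^sup>2 \<le> Z $$ (k, k) * bilin p Z x x"
proof (rule nonneg_quadratic_discriminant)
  fix t
  let ?e = "\<lambda>i. if i = k then 1 else 0 :: real"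
  have sym: "Z \<in> sym_mats p"
    using Z by (simp add: psd_cone_iff)
  have e: "bilin p Z ?e y = (\<Sum>j<p. Z $$ (k, j) * y j)" for y
  proof -
    have "bilin p Z ?e y = (\<Sum>i<p. if i = k then (\<Sum>j<p. Z $$ (k, j) * y j) else 0)"
      unfolding bilin_def by (intro sum.cong) auto
    then show ?thesis
      using k by simp
  qed
  have "0 \<le> bilin p Z (\<lambda>i. ?e i + t * x i) (\<lambda>i. ?e i + t * x i)"
    using Z by (simp only: psd_cone_iff)
  also have "\<dots> = bilin p Z ?e ?e + t * bilin p Z ?e x + t * bilin p Z x ?e + t\<^sup>2 * bilin p Z x x"
    unfolding bilin_def sum_distrib_left sum.distrib[symmetric]
    by (intro sum.cong refl) (simp add: algebra_simps power2_eq_square)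
  also have "bilin p Z x ?e = bilin p Z ?e x"
    by (rule bilin_commute[OF sym])
  finally show "0 \<le> Z $$ (k, k) + 2 * t * (\<Sum>j<p. Z $$ (k, j) * x j) + t\<^sup>2 * bilin p Z x x"
    unfolding e sum_mult_delta[OF k] by (simp add: algebra_simps)
qed

text \<open>Row \<open>k\<close> is scaled so that \<open>outer p x\<close> agrees with
  \<open>Z\<close> in that row; that the form stays nonnegative is exactly
  \<open>psd_row_bound\<close>.\<close>

lemma psd_deflate:
  assumes Z: "Z \<in> psd_cone p" and k: "k < p" and pos: "Z $$ (k, k) > 0"
  defines "x \<equiv> \<lambda>i. Z $$ (k, i) / sqrt (Z $$ (k, k))"
  shows "Z - outer p x \<in> psd_cone p"
proof -
  have sym: "Z \<in> sym_mats p"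
    using Z by (simp add: psd_cone_iff)
  have "Z - outer p x \<in> sym_mats p"
  proof (rule sym_matsI)
    show "Z - outer p x \<in> carrier_mat p p"
      by (rule minus_carrier_mat[OF outer_carrier])
    show "(Z - outer p x) $$ (i, j) = (Z - outer p x) $$ (j, i)" if "i < p" "j < p" for i j
      using that sym_matsD(2)[OF sym that] by simp
  qed
  moreover have "0 \<le> bilin p (Z - outer p x) y y" for y
  proof -
    have "(\<Sum>i<p. x i * y i) = (\<Sum>i<p. Z $$ (k, i) * y i) / sqrt (Z $$ (k, k))"
      by (simp add: x_def sum_divide_distrib)
    then have "(\<Sum>i<p. x i * y i)\<^sup>2 = (\<Sum>i<p. Z $$ (k, i) * y i)\<^sup>2 / Z $$ (k, k)"
      using pos by (simp add: power_divide)
    also have "\<dots> \<le> bilin p Z y y"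
      using psd_row_bound[OF Z k, of y] pos by (simp add: field_simps)
    finally have "bilin p (outer p x) y y \<le> bilin p Z y y"
      by (simp add: bilin_outer)
    moreover have "bilin p (Z - outer p x) y y = bilin p Z y y - bilin p (outer p x) y y"
      unfolding bilin_def sum_subtractf[symmetric]
      by (intro sum.cong refl) (simp add: algebra_simps)
    ultimately show ?thesis
      by simp
  qed
  ultimately show ?thesis
    by (simp add: psd_cone_iff)
qed

lemma psd_diag_nonneg:
  assumes "Z \<in> psd_cone p" "k < p"
  shows "0 \<le> Z $$ (k, k)"
proof (rule ccontr)
  assume *: "\<not> 0 \<le> Z $$ (k, k)"
  let ?e = "\<lambda>i. if i = k then 1 else 0 :: real"
  have "(\<Sum>j<p. Z $$ (k, j) * ?e j)\<^sup>2 \<le> Z $$ (k, k) * bilin p Z ?e ?e"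
    by (rule psd_row_bound[OF assms])
  moreover have "(\<Sum>j<p. Z $$ (k, j) * ?e j) = Z $$ (k, k)"
    by (rule sum_mult_delta[OF assms(2)])
  moreover have "0 \<le> bilin p Z ?e ?e"
    using assms(1) by (simp only: psd_cone_iff)
  \<comment> \<open>With a negative diagonal entry the right-hand side of the bound is
    nonpositive.\<close>
  ultimately have "(Z $$ (k, k))\<^sup>2 \<le> 0"
    using * by (smt (verit) mult_nonpos_nonneg)
  then show False
    using * by simp
qed

text \<open>
  By Cholesky deflation, a positive semidefinite \<open>Z\<close> is a sum of rank-one matrices, which all lie in
  any face that contains \<open>Z\<close>.
\<close>
lemma psd_inner_zero_if_outer:
  assumes W: "W \<in> carrier_mat p p"
    and D: "\<And>X Y. X \<in> psd_cone p \<Longrightarrow> Y \<in> psd_cone p \<Longrightarrow> X + Y \<in> D \<Longrightarrow> X \<in> D \<and> Y \<in> D"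
    and outer: "\<And>x. outer p x \<in> D \<Longrightarrow> mat_inner W (outer p x) = 0"
    and Z: "Z \<in> psd_cone p" "Z \<in> D"
  shows "mat_inner W Z = 0"
  using Z
proof (induction "card {i. i < p \<and> Z $$ (i, i) \<noteq> 0}" arbitrary: Z rule: less_induct)
  case less
  have Zc: "Z \<in> carrier_mat p p"
    using less.prems by (simp add: psd_cone_iff sym_mats_def)
  show ?case
  proof (cases "\<exists>k<p. Z $$ (k, k) \<noteq> 0")
    case False
    \<comment> \<open>A zero diagonal entry kills its whole row, so here \<open>Z\<close> is the
      zero matrix.\<close>
    have "Z $$ (i, j) = 0" if "i < p" "j < p" for i j
    proof -
      let ?e = "\<lambda>l. if l = j then 1 else 0 :: real"
      have "(\<Sum>l<p. Z $$ (i, l) * ?e l)\<^sup>2 \<le> Z $$ (i, i) * bilin p Z ?e ?e"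
        by (rule psd_row_bound[OF less.prems(1) that(1)])
      then show ?thesis
        using False that by (simp only: sum_mult_delta[OF that(2)]) simp
    qed
    then show ?thesis
      using Zc W by (simp add: mat_inner_eq_sum[where p=p])
  next
    case True
    then obtain k where k: "k < p" "Z $$ (k, k) \<noteq> 0"
      by blast
    with psd_diag_nonneg[OF less.prems(1)] have pos: "Z $$ (k, k) > 0"
      by (simp add: less_le)
    define x where "x = (\<lambda>i. Z $$ (k, i) / sqrt (Z $$ (k, k)))"
    let ?Z' = "Z - outer p x"
    have Z': "?Z' \<in> psd_cone p"
      unfolding x_def by (rule psd_deflate[OF less.prems(1) k(1) pos])
    have split: "outer p x + ?Z' = Z"
      using Zc by (intro eq_matI) auto
    have inD: "outer p x \<in> D" "?Z' \<in> D"
      using D[OF outer_psd Z'] split less.prems(2) by metis+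
    \<comment> \<open>Deflation clears the diagonal entry \<open>k\<close>. A zero entry stays zero,
      since it turns into \<open>- (x i * x i)\<close> and must be nonnegative.\<close>
    have "{i. i < p \<and> ?Z' $$ (i, i) \<noteq> 0} \<subset> {i. i < p \<and> Z $$ (i, i) \<noteq> 0}"
    proof
      show "{i. i < p \<and> ?Z' $$ (i, i) \<noteq> 0} \<subseteq> {i. i < p \<and> Z $$ (i, i) \<noteq> 0}"
      proof clarify
        fix i assume i: "i < p" "?Z' $$ (i, i) \<noteq> 0" "Z $$ (i, i) = 0"
        then have "?Z' $$ (i, i) = - (x i * x i)"
          using Zc by simp
        moreover have "0 \<le> ?Z' $$ (i, i)"
          by (rule psd_diag_nonneg[OF Z' i(1)])
        ultimately show False
          using i(2) zero_le_square[of "x i"] by linarith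
      qed
      have "x k * x k = Z $$ (k, k)"
        using pos by (simp add: x_def)
      then have "?Z' $$ (k, k) = 0"
        using k(1) Zc by simp
      then show "{i. i < p \<and> ?Z' $$ (i, i) \<noteq> 0} \<noteq> {i. i < p \<and> Z $$ (i, i) \<noteq> 0}"
        using k by blast
    qed
    then have "card {i. i < p \<and> ?Z' $$ (i, i) \<noteq> 0} < card {i. i < p \<and> Z $$ (i, i) \<noteq> 0}"
      by (rule psubset_card_mono[rotated]) simp
    then have "mat_inner W ?Z' = 0"
      by (rule less.hyps[OF _ Z' inD(2)])
    moreover have "?Z' \<in> carrier_mat p p"
      using Z' by (simp add: psd_cone_iff sym_mats_def)
    ultimately show ?thesis
      using mat_inner_add_right[OF W outer_carrier, of ?Z' x] outer[OF inD(1)] split by simp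
  qed
qed

section \<open>The matrices \<open>Phi\<close> and the orthogonal complement of the affine
  space\<close>

lemma mat_inner_Phi_outer:
  assumes "c \<in> carrier_vec r"
  shows "mat_inner (Phi c) (outer (Suc r) x) =
    (\<Sum>j<r. c $ j * x (Suc j))\<^sup>2 - x 0 * (\<Sum>j<r. c $ j * x (Suc j))"
proof -
  have carr: "Phi c \<in> carrier_mat (Suc r) (Suc r)"
    using Phi_carrier[OF assms] by simp
  have 00: "Phi c $$ (0, 0) = 0"
    using assms by (auto simp: Phi_def Let_def)
  let ?s = "\<Sum>j<r. c $ j * x (Suc j)"
  have "mat_inner (Phi c) (outer (Suc r) x) =
      (\<Sum>j<r. x 0 * (- c $ j / 2) * x (Suc j)) +
      (\<Sum>i<r. x (Suc i) * (- c $ i / 2) * x 0 + (\<Sum>j<r. x (Suc i) * (c $ i * c $ j) * x (Suc j)))"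
    unfolding mat_inner_outer[OF carr] bilin_def sum.lessThan_Suc_shift
    using Phi_index[OF assms] by (simp add: 00)
  \<comment> \<open>Each off-diagonal block contributes \<open>- x 0 / 2\<close> times the linear
    form, and the lower right block its square.\<close>
  also have "\<dots> = (- x 0 / 2) * ?s + ((- x 0 / 2) * ?s + (\<Sum>i<r. \<Sum>j<r. (c $ i * x (Suc i)) * (c $ j * x (Suc j))))"
    unfolding sum.distrib sum_distrib_left
    by (intro arg_cong2[of _ _ _ _ "(+)"] sum.cong refl) simp_all
  finally show ?thesis
    by (simp add: power2_eq_square sum_product[symmetric])
qed

text \<open>\<open>W\<close> vanishes wherever all \<open>Phi (row C i)\<close> do, hence is a
  combination of them as a functional on symmetric matrices. The constraint on the corner adds no
  term, because \<open>?E\<close> is feasible and so orthogonal to \<open>W\<close>.\<close>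

lemma perp_T_affine_quadratic:
  assumes C: "C \<in> carrier_mat n r" and W: "W \<in> perp (Suc r) (T_affine C)"
  shows "\<exists>a. \<forall>x. mat_inner W (outer (Suc r) x) =
    (\<Sum>i<n. a i * ((\<Sum>j<r. C $$ (i, j) * x (Suc j))\<^sup>2 - x 0 * (\<Sum>j<r. C $$ (i, j) * x (Suc j))))"
proof -
  let ?p = "Suc r"
  let ?S = "sym_mats ?p"
  let ?comb = "\<lambda>X c Y. X + (- c) \<cdot>\<^sub>m Y :: real mat"
  let ?E = "outer ?p (\<lambda>i. if i = 0 then 1 else 0)"
  have Wc: "W \<in> carrier_mat ?p ?p"
    using W by (simp add: perp_def sym_mats_def)
  have dims: "dim_row C = n" "dim_col C = r"
    using C by auto
  have row: "row C i \<in> carrier_vec r" for i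
    using dims by (simp add: carrier_vecI)
  have Phic: "Phi (row C i) \<in> carrier_mat ?p ?p" for i
    using Phi_carrier[OF row] by simp
  have comb: "?comb X c Y \<in> ?S" if "X \<in> ?S" "Y \<in> ?S" for X Y c
    using sym_matsD[OF that(1)] sym_matsD[OF that(2)] by (intro sym_matsI) auto
  have lin: "mat_inner V (?comb X c Y) = mat_inner V X - c * mat_inner V Y"
    if "V \<in> carrier_mat ?p ?p" "X \<in> ?S" "Y \<in> ?S" for V X Y c
    using that sym_matsD(1)[OF that(2)] sym_matsD(1)[OF that(3)]
    by (simp add: mat_inner_add_right[where p="?p"] mat_inner_smult_right[where p="?p"])
  have PhiE: "mat_inner (Phi (row C i)) ?E = 0" for i
    using mat_inner_Phi_outer[OF row, of i "\<lambda>i. if i = 0 then 1 else 0"] by simp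
  have perp: "mat_inner W X = 0" if "X \<in> ?S" "X $$ (0, 0) = 1" "\<And>i. i < n \<Longrightarrow> mat_inner (Phi (row C i)) X = 0" for X
    using W that by (simp add: perp_def T_affine_def dims)
  have WE: "mat_inner W ?E = 0"
    by (rule perp) (auto simp: outer_sym PhiE)
  have "\<exists>a. \<forall>X\<in>?S. mat_inner W X = (\<Sum>i<n. a i * mat_inner (Phi (row C i)) X)"
  proof (rule functional_in_span[where comb="?comb"])
    fix X assume X: "X \<in> ?S" and 0: "\<And>i. i < n \<Longrightarrow> mat_inner (Phi (row C i)) X = 0"
    \<comment> \<open>A multiple of \<open>?E\<close> moves the corner entry to 1 without disturbing
      the other constraints.\<close>
    let ?X = "?comb X (X $$ (0, 0) - 1) ?E"
    have "mat_inner W ?X = 0"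
    proof (rule perp)
      show "?X \<in> ?S"
        by (rule comb[OF X outer_sym])
      show "?X $$ (0, 0) = 1"
        using sym_matsD(1)[OF X] by simp
      show "mat_inner (Phi (row C i)) ?X = 0" if "i < n" for i
        using that by (simp only: lin[OF Phic X outer_sym] 0 PhiE)
    qed
    then show "mat_inner W X = 0"
      unfolding lin[OF Wc X outer_sym] WE by simp
  qed (use comb lin Wc Phic in auto)
  then obtain a where a: "\<And>X. X \<in> ?S \<Longrightarrow> mat_inner W X = (\<Sum>i<n. a i * mat_inner (Phi (row C i)) X)"
    by blast
  have "(\<Sum>j<r. row C i $ j * x j) = (\<Sum>j<r. C $$ (i, j) * x j)" if "i < n" for i and x :: "nat \<Rightarrow> real"
    using that dims by (intro sum.cong) auto
  then have "mat_inner W (outer ?p x) =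
    (\<Sum>i<n. a i * ((\<Sum>j<r. C $$ (i, j) * x (Suc j))\<^sup>2 - x 0 * (\<Sum>j<r. C $$ (i, j) * x (Suc j))))" for x
    unfolding a[OF outer_sym] mat_inner_Phi_outer[OF row] by (intro sum.cong) auto
  then show ?thesis
    by blast
qed

section \<open>Facial reduction sequences\<close>

text \<open>By induction along the sequence: \<open>W\<close> is nonnegative at \<open>X\<close> and
  \<open>Y\<close> on the previous face, so if it vanishes at the sum it vanishes at both.\<close>

lemma face_seq_split:
  assumes seq: "facial_reduction_seq p L d F W" and "j \<le> d"
    and "X \<in> psd_cone p" "Y \<in> psd_cone p" "X + Y \<in> F j"
  shows "X \<in> F j \<and> Y \<in> F j"
  using assms(2-)
proof (induction j)
  case 0
  then show ?case
    using seq by (simp add: facial_reduction_seq_def)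
next
  case (Suc j)
  have W: "W (Suc j) \<in> dual_cone p (F j)" and F: "F (Suc j) = F j \<inter> perp p {W (Suc j)}"
    using seq Suc.prems(1) by (auto simp: facial_reduction_seq_def dest!: bspec[of _ _ "Suc j"])
  have XY: "X \<in> F j" "Y \<in> F j"
    using Suc F by auto
  have carr: "X \<in> carrier_mat p p" "Y \<in> carrier_mat p p" "W (Suc j) \<in> carrier_mat p p"
    using Suc.prems(2,3) W by (simp_all add: psd_cone_iff dual_cone_def sym_mats_def)
  have "mat_inner (X + Y) (W (Suc j)) = 0"
    using Suc.prems(4) F by (simp add: perp_def)
  then have "mat_inner (W (Suc j)) X + mat_inner (W (Suc j)) Y = 0"
    using mat_inner_add_right[OF carr(3,1,2)] mat_inner_commute[OF carr(3), of "X + Y"] carr by simp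
  moreover have "0 \<le> mat_inner (W (Suc j)) X" "0 \<le> mat_inner (W (Suc j)) Y"
    using W XY by (auto simp: dual_cone_def)
  ultimately have "mat_inner X (W (Suc j)) = 0" "mat_inner Y (W (Suc j)) = 0"
    using mat_inner_commute[OF carr(3,1)] mat_inner_commute[OF carr(3,2)] by linarith+
  then show ?case
    using XY F Suc.prems(2,3) by (simp add: perp_def psd_cone_iff)
qed

text \<open>Turns an indexed chain without stalling steps into list form. The induction runs down
  from \<open>d\<close>, so that the list grows at its head.\<close>

lemma reduction_drops_chain:
  fixes U :: "nat \<Rightarrow> ('i \<Rightarrow> real) set"
  assumes "\<And>j. j < d \<Longrightarrow> U (Suc j) = {u \<in> U j. g j u = 0}"
    and "\<And>j. j < d \<Longrightarrow> \<exists>u\<in>U j. g j u \<noteq> 0"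
    and "\<And>j. j < d \<Longrightarrow>
      \<exists>y. \<forall>u\<in>U j. g j u = (\<Sum>i\<in>I. y i * (u i)\<^sup>2) \<and> (\<Sum>i\<in>I. y i * u i) = 0 \<and> 0 \<le> g j u"
    and "j \<le> d"
  shows "reduction I (map g [j..<d]) (U j) \<and> drops (map g [j..<d]) (U j) = d - j"
  using assms(4)
proof (induction rule: inc_induct)
  case (step j)
  have map: "map g [j..<d] = g j # map g [Suc j..<d]"
    using step by (simp add: upt_conv_Cons)
  have U: "{u \<in> U j. g j u = 0} = U (Suc j)"
    by (rule assms(1)[symmetric, OF step(2)])
  have "reduction I (map g [j..<d]) (U j)"
    unfolding map reduction.simps U by (rule conjI[OF assms(3)[OF step(2)] conjunct1[OF step(3)]])
  moreover have "drops (map g [j..<d]) (U j) = 1 + (d - Suc j)"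
    unfolding map drops.simps U using assms(2)[OF step(2)] step(3) by simp
  ultimately show ?case
    using step(2) by simp
qed simp

section \<open>Full column rank and the column space\<close>

lemma full_column_rank_imp_kernel_trivial:
  assumes C: "(C :: real mat) \<in> carrier_mat n r" and rank: "vec_space.rank n C = r"
    and v: "v \<in> carrier_vec r" "C *\<^sub>v v = 0\<^sub>v n"
  shows "v = 0\<^sub>v r"
proof -
  interpret vec_space "TYPE(real)" n .
  obtain S where S: "maximal S (\<lambda>T. T \<subseteq> set (cols C) \<and> lin_indpt T)"
    using maximal_exists[of "(\<lambda>T. T \<subseteq> set (cols C) \<and> lin_indpt T)" "card (set (cols C))" "{}"]
    by (meson List.finite_set card_mono empty_iff empty_subsetI finite_lin_indpt2 rev_finite_subset)
  have "r = card S"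
    using rank_card_indpt[OF C S] rank by simp
  also have "\<dots> \<le> card (set (cols C))"
    using S by (simp add: card_mono maximal_def)
  \<comment> \<open>Independence concerns the set of columns, where a repetition would go unnoticed;
    counting against the rank excludes one.\<close>
  finally have "distinct (cols C)"
    using C card_length[of "cols C"] by (intro card_distinct) simp
  then show ?thesis
    using full_rank_lin_indpt[OF C rank] lin_depI[OF C v(1) _ v(2)] by blast
qed

text \<open>The product \<open>C x\<close>, with default 0 beyond the rows so that it lies in
  \<open>supp_on {..<n}\<close>.\<close>

definition col_comb :: "nat \<Rightarrow> nat \<Rightarrow> real mat \<Rightarrow> (nat \<Rightarrow> real) \<Rightarrow> nat \<Rightarrow> real" where
  "col_comb n r C x = (\<lambda>i. if i < n then \<Sum>j<r. C $$ (i, j) * x j else 0)"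

lemma linear_col_comb: "linear (col_comb n r C)"
  by (rule linearI)
    (auto simp: col_comb_def fun_eq_iff algebra_simps sum.distrib sum_distrib_left)

lemma col_comb_supp_on: "range (col_comb n r C) \<subseteq> supp_on {..<n}"
  by (auto simp: col_comb_def supp_on_def)

text \<open>Only the first \<open>r\<close> entries of the argument matter, and on
  \<open>supp_on {..<r}\<close> the map is injective by full rank.\<close>

lemma dim_range_col_comb:
  assumes C: "C \<in> carrier_mat n r" and rank: "vec_space.rank n C = r"
  shows "dim (range (col_comb n r C)) = r"
proof -
  have "col_comb n r C x \<in> col_comb n r C ` supp_on {..<r}" for x
  proof
    show "restrict_fun {..<r} x \<in> supp_on {..<r}"
      by (rule restrict_fun_supp_on)
    show "col_comb n r C x = col_comb n r C (restrict_fun {..<r} x)"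
      unfolding col_comb_def restrict_fun_def by (intro ext if_cong sum.cong) auto
  qed
  then have "range (col_comb n r C) = col_comb n r C ` supp_on {..<r}"
    by blast
  moreover have "dim (col_comb n r C ` supp_on {..<r}) = dim (supp_on {..<r})"
  proof (rule dim_image_inj_fin_dim[OF linear_col_comb subspace_supp_on])
    fix x assume x: "x \<in> supp_on {..<r}" "col_comb n r C x = 0"
    have "C *\<^sub>v vec r x = 0\<^sub>v n"
    proof (rule eq_vecI)
      fix i assume i: "i < dim_vec (0\<^sub>v n :: real vec)"
      then have "(C *\<^sub>v vec r x) $ i = (\<Sum>j<r. C $$ (i, j) * x j)"
        using C by (auto simp: scalar_prod_def atLeast0LessThan intro!: sum.cong)
      also have "\<dots> = col_comb n r C x i"
        using i by (simp add: col_comb_def)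
      finally show "(C *\<^sub>v vec r x) $ i = 0\<^sub>v n $ i"
        using x(2) i by simp
    qed (use C in auto)
    then have 0: "vec r x = 0\<^sub>v r"
      by (rule full_column_rank_imp_kernel_trivial[OF C rank vec_carrier])
    have "x j = 0" for j
    proof (cases "j < r")
      case True
      then have "x j = vec r x $ j" by simp
      also have "\<dots> = 0" using 0 True by simp
      finally show ?thesis .
    next
      case False
      then show ?thesis using x(1) by (simp add: supp_on_def)
    qed
    then show "x = 0"
      by (simp add: fun_eq_iff)
  qed (rule fin_dim_supp_on, simp)
  ultimately show ?thesis
    by (simp add: dim_supp_on)
qed

text \<open>Every reduction gives a strict inclusion of subspaces, so \<open>drops\<close> equals
  \<open>d\<close>; \<open>drops_le_dim\<close> then bounds \<open>d\<close> by \<open>r\<close> and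
  \<open>drops_add_dim_le_card\<close> by \<open>n - r\<close>.\<close>

lemma facial_reduction_seq_length_le:
  assumes C: "C \<in> carrier_mat n r" and rank: "vec_space.rank n C = r"
    and seq: "facial_reduction_seq (Suc r) (T_affine C) d F W"
  shows "d \<le> min (n - r) r"
proof -
  let ?p = "Suc r"
  \<comment> \<open>Index 0 holds the homogenizing coordinate; \<open>?A\<close> drops it and
    applies \<open>C\<close> to the rest.\<close>
  let ?A = "\<lambda>x :: nat \<Rightarrow> real. col_comb n r C (\<lambda>j. x (Suc j))"
  have W: "W (Suc j) \<in> perp ?p (T_affine C)" "W (Suc j) \<in> dual_cone ?p (F j)"
      "W (Suc j) \<notin> perp ?p (F j)" "F (Suc j) = F j \<inter> perp ?p {W (Suc j)}" if "j < d" for j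
    using seq that by (auto simp: facial_reduction_seq_def dest!: bspec[of _ _ "Suc j"])
  have sym: "W (Suc j) \<in> sym_mats ?p" if "j < d" for j
    using W(1)[OF that] by (simp add: perp_def)
  note carr = sym_matsD(1)[OF sym]
  have "\<exists>y. \<forall>j\<in>{..<d}. \<forall>x. mat_inner (W (Suc j)) (outer ?p x) =
      (\<Sum>i<n. y j i * ((\<Sum>k<r. C $$ (i, k) * x (Suc k))\<^sup>2 - x 0 * (\<Sum>k<r. C $$ (i, k) * x (Suc k))))"
    by (intro bchoice ballI perp_T_affine_quadratic[OF C] W(1)) simp
  then obtain y where y': "\<forall>j\<in>{..<d}. \<forall>x. mat_inner (W (Suc j)) (outer ?p x) =
      (\<Sum>i<n. y j i * ((\<Sum>k<r. C $$ (i, k) * x (Suc k))\<^sup>2 - x 0 * (\<Sum>k<r. C $$ (i, k) * x (Suc k))))"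
    by (elim exE)
  have y: "mat_inner (W (Suc j)) (outer ?p x) =
      (\<Sum>i<n. y j i * ((\<Sum>k<r. C $$ (i, k) * x (Suc k))\<^sup>2 - x 0 * (\<Sum>k<r. C $$ (i, k) * x (Suc k))))"
    if "j < d" for j x
    using that by (intro y'[rule_format]) simp
  define g where "g j u = (\<Sum>i<n. y j i * (u i)\<^sup>2)" for j and u :: "nat \<Rightarrow> real"
  define l where "l j u = (\<Sum>i<n. y j i * u i)" for j and u :: "nat \<Rightarrow> real"
  have inner: "mat_inner (W (Suc j)) (outer ?p x) = g j (?A x) - x 0 * l j (?A x)" if "j < d" for j x
  proof -
    have "x 0 * l j (?A x) = (\<Sum>i<n. x 0 * (y j i * ?A x i))"
      unfolding l_def by (rule sum_distrib_left)
    then show ?thesis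
      unfolding y[OF that] g_def
      by (simp add: sum_subtractf[symmetric] col_comb_def right_diff_distrib mult.left_commute)
  qed
  define U where "U = rec_nat (range (col_comb n r C)) (\<lambda>j V. {u \<in> V. g j u = 0})"
  have U0: "U 0 = range (col_comb n r C)" and USuc: "U (Suc j) = {u \<in> U j. g j u = 0}" for j
    by (simp_all add: U_def)
  have Urange: "U j \<subseteq> range (col_comb n r C)" for j
    by (induction j) (auto simp: U0 USuc)
  \<comment> \<open>Membership of \<open>outer ?p x\<close> in the face leaves \<open>x 0\<close>
    free, so \<open>g j u - t * l j u\<close> is nonnegative for every \<open>t\<close>.\<close>
  have step: "(\<forall>u\<in>U j. l j u = 0 \<and> 0 \<le> g j u)"
    if "j < d" "\<And>x. outer ?p x \<in> F j \<longleftrightarrow> ?A x \<in> U j" for j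
  proof
    fix u assume u: "u \<in> U j"
    then obtain v where v: "u = col_comb n r C v"
      using Urange by blast
    have nonneg: "0 \<le> g j u - t * l j u" for t
    proof -
      define x where "x = (\<lambda>i. case i of 0 \<Rightarrow> t | Suc k \<Rightarrow> v k)"
      have x: "x 0 = t" "?A x = u"
        by (simp_all add: x_def v)
      then have "outer ?p x \<in> F j"
        using that(2) u by simp
      then have "0 \<le> mat_inner (W (Suc j)) (outer ?p x)"
        using W(2)[OF that(1)] by (simp add: dual_cone_def)
      then show ?thesis
        using inner[OF that(1), of x] x by simp
    qed
    \<comment> \<open>Otherwise \<open>t = (g j u + 1) / l j u\<close> would give the value
      -1.\<close>
    have "l j u = 0"
    proof (rule ccontr)
      assume "l j u \<noteq> 0"
      then show False
        using nonneg[of "(g j u + 1) / l j u"] by simp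
    qed
    then show "l j u = 0 \<and> 0 \<le> g j u"
      using nonneg[of 0] by simp
  qed
  \<comment> \<open>The linear part vanishes on \<open>U j\<close>, so orthogonality to
    \<open>W (Suc j)\<close> is the condition \<open>g j = 0\<close> that cuts out the next
    subspace.\<close>
  have rep: "outer ?p x \<in> F j \<longleftrightarrow> ?A x \<in> U j" if "j \<le> d" for j x
    using that
  proof (induction j arbitrary: x)
    case 0
    have "F 0 = psd_cone ?p"
      using seq by (simp add: facial_reduction_seq_def)
    then show ?case
      using outer_psd by (simp add: U0)
  next
    case (Suc j)
    then have j: "j < d" by simp
    have IH: "outer ?p x \<in> F j \<longleftrightarrow> ?A x \<in> U j" for x
      using Suc by simp
    have "outer ?p x \<in> F (Suc j) \<longleftrightarrow> outer ?p x \<in> F j \<and> mat_inner (W (Suc j)) (outer ?p x) = 0"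
      using W(4)[OF j] outer_sym[of ?p x] mat_inner_commute[OF carr[OF j] outer_carrier]
      by (simp add: perp_def)
    also have "\<dots> \<longleftrightarrow> ?A x \<in> U j \<and> g j (?A x) = 0"
      using step[OF j IH] inner[OF j, of x] IH by auto
    finally show ?case
      by (simp add: USuc)
  qed
  \<comment> \<open>If \<open>g j\<close> vanished on \<open>U j\<close>, then
    \<open>W (Suc j)\<close> would vanish on all rank-one matrices of the face and hence on the
    face, against its choice.\<close>
  have nontriv: "\<exists>u\<in>U j. g j u \<noteq> 0" if j: "j < d" for j
  proof (rule ccontr)
    assume *: "\<not> (\<exists>u\<in>U j. g j u \<noteq> 0)"
    have rep': "outer ?p x \<in> F j \<longleftrightarrow> ?A x \<in> U j" for x
      using rep j by simp
    have "mat_inner (W (Suc j)) Z = 0" if Z: "Z \<in> F j" for Z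
    proof (rule psd_inner_zero_if_outer[OF carr[OF j] _ _ _ Z])
      show "X \<in> F j \<and> Y \<in> F j" if "X \<in> psd_cone ?p" "Y \<in> psd_cone ?p" "X + Y \<in> F j" for X Y
        using face_seq_split[OF seq _ that] j by simp
      show "mat_inner (W (Suc j)) (outer ?p x) = 0" if "outer ?p x \<in> F j" for x
        using that inner[OF j, of x] step[OF j rep'] rep' * by auto
      have "mat_face_of (F j) (psd_cone ?p)"
        using seq j by (simp add: facial_reduction_seq_def)
      then show "Z \<in> psd_cone ?p"
        using Z by (auto simp: mat_face_of_def)
    qed
    then show False
      using W(3)[OF j] sym[OF j] by (simp add: perp_def)
  qed
  have "reduction {..<n} (map g [0..<d]) (U 0) \<and> drops (map g [0..<d]) (U 0) = d - 0"
  proof (rule reduction_drops_chain)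
    show "\<exists>y. \<forall>u\<in>U j. g j u = (\<Sum>i<n. y i * (u i)\<^sup>2) \<and> (\<Sum>i<n. y i * u i) = 0 \<and> 0 \<le> g j u"
      if "j < d" for j
      using step[OF that] rep that by (intro exI[of _ "y j"]) (simp add: g_def l_def)
  qed (use USuc nontriv in auto)
  then have red: "reduction {..<n} (map g [0..<d]) (U 0)" and d: "drops (map g [0..<d]) (U 0) = d"
    by simp_all
  have subU: "Real_Vector_Spaces.subspace (U 0)"
    unfolding U0 by (rule linear_subspace_image[OF linear_col_comb subspace_UNIV])
  have supp: "U 0 \<subseteq> supp_on {..<n}"
    unfolding U0 by (rule col_comb_supp_on)
  have dimU: "dim (U 0) = r"
    unfolding U0 by (rule dim_range_col_comb[OF C rank])
  have "fin_dim (U 0)"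
    by (rule fin_dim_subset[OF supp fin_dim_supp_on]) simp
  then have "d \<le> r"
    using drops_le_dim[OF subU _ red] d dimU by simp
  moreover have "d + r \<le> n"
  proof -
    have "drops (map g [0..<d]) (U 0) + dim (U 0) \<le> card {..<n}"
    proof (rule drops_add_dim_le_card[OF _ _ subU supp _ red])
      show "u = 0" if u: "u \<in> U 0" and 0: "\<And>i. i \<in> {..<n} \<Longrightarrow> u i = 0" for u
      proof
        fix i
        show "u i = 0 i"
          using 0[of i] subsetD[OF supp u] by (cases "i < n") (simp_all add: supp_on_def)
      qed
    qed auto
    then show ?thesis
      using d dimU by simp
  qed
  ultimately show ?thesis
    by simp
qed

theorem theorem5p1:
  fixes C :: "real mat" and n r :: nat
  assumes "r \<le> n"
    and "C \<in> carrier_mat n r"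
    and "vec_space.rank n C = r"
  shows "MSD_T C \<le> enat (min (n - r) r)"
proof -
  have "dim_col C = r"
    using assms(2) by simp
  then have "MSD_T C = msd (Suc r) (T_affine C)"
    by (simp add: MSD_T_def)
  also have "\<dots> \<le> enat (min (n - r) r)"
    unfolding msd_def
  proof (rule SUP_least)
    fix d assume "d \<in> {d. \<exists>F W. facial_reduction_seq (Suc r) (T_affine C) d F W}"
    then have "d \<le> min (n - r) r"
      using facial_reduction_seq_length_le[OF assms(2,3)] by blast
    then show "enat d \<le> enat (min (n - r) r)"
      by (simp only: enat_ord_simps)
  qed
  finally show ?thesis .
qed

end
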